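(* For every program $M$ (closed term of type $\mathrm{bool}=\mathrm{void}+\mathrm{void}$): $\mathcal O(M)=[\![M]\!]$.
   Context: Types: type expressions $\sigma ::= t \mid \sigma+\sigma \mid \sigma\times\sigma\mid \sigma\to\sigma\mid \mu t.\sigma\mid \mathrm{void}$ (types = closed ones); types having the same infinite unfolding (type tree, obtained from repeated unfoldings $\mu t.\tau\rhd\tau[\mu t.\tau/t]$) are equivalent and interchangeable in typing. Terms: typed $\lambda$-terms over typed variables and the constants, for all types $\sigma,\tau,\rho$: $0_{\sigma,\tau}:\sigma\to(\sigma+\tau)$, $1_{\sigma,\tau}:\tau\to(\sigma+\tau)$, $\mathrm{case}_{\sigma,\tau,\rho}:(\sigma+\tau)\to(\sigma\to\rho)\to(\tau\to\rho)\to\rho$, $\mathrm{pcase}_{\sigma,\tau,\rho}:(\sigma+\tau)\to\rho\to\rho\to\rho$, $\mathrm{pair}_{\sigma,\tau}:\sigma\to\tau\to(\sigma\times\tau)$, $\mathrm{fst}:(\sigma\times\tau)\to\sigma$, $\mathrm{snd}:(\sigma\times\tau)\to\tau$, $\Omega_\sigma:\sigma$. Reduction $\to$: $\beta$-reduction and $\mathrm{case}(0x)yz\to yx$; $\mathrm{case}(1x)yz\to zx$; $\mathrm{fst}(\mathrm{pair}\,x\,y)\to x$; $\mathrm{snd}(\mathrm{pair}\,x\,y)\to y$; $\mathrm{pcase}(0x)yz\to y$; $\mathrm{pcase}(1x)yz\to z$; $\mathrm{pcase}\,x(0y)(0z)\to 0(\mathrm{pcase}\,xyz)$; $\mathrm{pcase}\,x(1y)(1z)\to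 1(\mathrm{pcase}\,xyz)$; $\mathrm{pcase}\,x(\mathrm{pair}\,y_1y_2)(\mathrm{pair}\,z_1z_2)\to\mathrm{pair}(\mathrm{pcase}\,x\,y_1z_1)(\mathrm{pcase}\,x\,y_2z_2)$; $(\mathrm{pcase}\,xyz)w\to\mathrm{pcase}\,x(yw)(zw)$ (functional result type), applied in any context; $\to^*$ reflexive transitive closure. Semantics: each type $\sigma$ is interpreted by a prime system with domain $D_\sigma$ of elements (downward closed, pairwise consistent sets of primes, $\bot=\emptyset$): $D_{\mathrm{void}}=\{\bot\}$; $D_{\tau+\rho}=\{\bot\}\cup\{0d\}\cup\{1d\}$ with $0d=\{0\}\cup(\{0\}\times d)$, $1d=\{1\}\cup(\{1\}\times d)$ (so $D_{\mathrm{bool}}=\{\bot,0,1\}$ with $0=\{0\}$, $1=\{1\}$); products are pairs; $D_{\tau\to\rho}$ is isomorphic to continuous functions; recursive types are interpreted as the union of the chain of prime systems of finite prefixes of the type tree. $[\![M]\!]$ for closed $M$ is the denotation: $\Omega\mapsto\bot$, $0,1$ injections, $\mathrm{case}\,\bot fg=\bot$, $\mathrm{case}\,(0e)fg=f\,e$, $\mathrm{case}\,(1e)fg=g\,e$, $\mathrm{pcase}\,\bot bc=b\cap c$, $\mathrm{pcase}\,(0a)bc=b$, $\mathrm{pcase}\,(1a)bc=c$, pairing and projections, with abstraction/application interpreted as function formation/application. Operational evaluation: for a program $M$, $\mathcal O(M)=0$ if $M\to^*0M'$ for some $M'$, $\mathcal O(M)=1$ if $M\to^*1M'$ for some $M'$,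 and $\mathcal O(M)=\bot$ otherwise. *)

theory Defs
  imports Main "HOL-Library.FSet"
begin

section \<open>Types\<close>

text \<open>Type expressions with de Bruijn indices: \<^term>\<open>TMu\<close> binds index 0.\<close>

datatype (discs_sels) ty =
    TVar nat
  | TSum ty ty
  | TProd ty ty
  | TFun ty ty
  | TMu ty
  | TVoid

fun ty_lift :: "nat \<Rightarrow> ty \<Rightarrow> ty" where
  "ty_lift k (TVar i) = (if i < k then TVar i else TVar (Suc i))"
| "ty_lift k (TSum a b) = TSum (ty_lift k a) (ty_lift k b)"
| "ty_lift k (TProd a b) = TProd (ty_lift k a) (ty_lift k b)"
| "ty_lift k (TFun a b) = TFun (ty_lift k a) (ty_lift k b)"
| "ty_lift k (TMu a) = TMu (ty_lift (Suc k) a)"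
| "ty_lift k TVoid = TVoid"

fun ty_subst :: "ty \<Rightarrow> nat \<Rightarrow> ty \<Rightarrow> ty" where
  "ty_subst s k (TVar i) = (if i < k then TVar i else if i = k then s else TVar (i - 1))"
| "ty_subst s k (TSum a b) = TSum (ty_subst s k a) (ty_subst s k b)"
| "ty_subst s k (TProd a b) = TProd (ty_subst s k a) (ty_subst s k b)"
| "ty_subst s k (TFun a b) = TFun (ty_subst s k a) (ty_subst s k b)"
| "ty_subst s k (TMu a) = TMu (ty_subst (ty_lift 0 s) (Suc k) a)"
| "ty_subst s k TVoid = TVoid"

fun ty_free_below :: "nat \<Rightarrow> ty \<Rightarrow> bool" where
  "ty_free_below k (TVar i) \<longleftrightarrow> i < k"
| "ty_free_below k (TSum a b) \<longleftrightarrow> ty_free_below k a \<and> ty_free_below k b"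
| "ty_free_below k (TProd a b) \<longleftrightarrow> ty_free_below k a \<and> ty_free_below k b"
| "ty_free_below k (TFun a b) \<longleftrightarrow> ty_free_below k a \<and> ty_free_below k b"
| "ty_free_below k (TMu a) \<longleftrightarrow> ty_free_below (Suc k) a"
| "ty_free_below k TVoid \<longleftrightarrow> True"

definition closed_ty :: "ty \<Rightarrow> bool" where
  "closed_ty s \<longleftrightarrow> ty_free_below 0 s"

definition ty_bool :: ty where
  "ty_bool = TSum TVoid TVoid"

text \<open>Unfolding at the root. It is deterministic and stops exactly at expressions that do
  not start with \<open>\<mu>\<close>. A closed type whose root can be unfolded forever, such as \<open>\<mu>t. t\<close>,
  has the same tree as \<open>void\<close>.\<close>

inductive ty_unfold :: "ty \<Rightarrow> ty \<Rightarrow> bool" where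
  "ty_unfold (TMu s) (ty_subst (TMu s) 0 s)"

definition ty_head :: "ty \<Rightarrow> ty" where
  "ty_head s =
     (if \<exists>t. ty_unfold\<^sup>*\<^sup>* s t \<and> \<not> (\<exists>a. t = TMu a)
      then (THE t. ty_unfold\<^sup>*\<^sup>* s t \<and> \<not> (\<exists>a. t = TMu a))
      else TVoid)"

codatatype ty_tree =
    NVoid
  | NSum ty_tree ty_tree
  | NProd ty_tree ty_tree
  | NFun ty_tree ty_tree

text \<open>Only the trees of closed types matter; a free variable at the root is sent to \<^term>\<open>NVoid\<close>.\<close>

primcorec tree_of :: "ty \<Rightarrow> ty_tree" where
  "tree_of s =
     (case ty_head s of
        TSum a b \<Rightarrow> NSum (tree_of a) (tree_of b)
      | TProd a b \<Rightarrow> NProd (tree_of a) (tree_of b)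
      | TFun a b \<Rightarrow> NFun (tree_of a) (tree_of b)
      | TVoid \<Rightarrow> NVoid
      | TVar i \<Rightarrow> NVoid
      | TMu a \<Rightarrow> NVoid)"

definition ty_equiv :: "ty \<Rightarrow> ty \<Rightarrow> bool" (infix "\<approx>" 50) where
  "s \<approx> t \<longleftrightarrow> tree_of s = tree_of t"


section \<open>Terms\<close>

datatype const =
    In0 ty ty
  | In1 ty ty
  | Case ty ty ty
  | Pcase ty ty ty
  | Pair ty ty
  | Fst ty ty
  | Snd ty ty
  | Omega ty

fun const_ty :: "const \<Rightarrow> ty" where
  "const_ty (In0 s t) = TFun s (TSum s t)"
| "const_ty (In1 s t) = TFun t (TSum s t)"
| "const_ty (Case s t r) = TFun (TSum s t) (TFun (TFun s r) (TFun (TFun t r) r))"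
| "const_ty (Pcase s t r) = TFun (TSum s t) (TFun r (TFun r r))"
| "const_ty (Pair s t) = TFun s (TFun t (TProd s t))"
| "const_ty (Fst s t) = TFun (TProd s t) s"
| "const_ty (Snd s t) = TFun (TProd s t) t"
| "const_ty (Omega s) = s"

text \<open>Terms modulo \<open>\<alpha>\<close>-conversion, with de Bruijn indices.\<close>

datatype tm =
    Var nat
  | Const const
  | App tm tm  (infixl "\<bullet>" 200)
  | Lam ty tm

text \<open>The context lists the types of the free variables. Every type in a derivation is closed,
  and types with the same tree may be exchanged.\<close>

inductive has_ty :: "ty list \<Rightarrow> tm \<Rightarrow> ty \<Rightarrow> bool" where
  ty_Var: "i < length G \<Longrightarrow> closed_ty (G ! i) \<Longrightarrow> has_ty G (Var i) (G ! i)"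
| ty_Const: "closed_ty (const_ty c) \<Longrightarrow> has_ty G (Const c) (const_ty c)"
| ty_App: "has_ty G M (TFun s t) \<Longrightarrow> has_ty G N s \<Longrightarrow> has_ty G (M \<bullet> N) t"
| ty_Lam: "closed_ty s \<Longrightarrow> has_ty (s # G) M t \<Longrightarrow> has_ty G (Lam s M) (TFun s t)"
| ty_conv: "has_ty G M s \<Longrightarrow> s \<approx> t \<Longrightarrow> closed_ty t \<Longrightarrow> has_ty G M t"

definition program :: "tm \<Rightarrow> bool" where
  "program M \<longleftrightarrow> has_ty [] M ty_bool"


section \<open>Reduction\<close>

fun lift :: "nat \<Rightarrow> tm \<Rightarrow> tm" where
  "lift k (Var i) = (if i < k then Var i else Var (Suc i))"
| "lift k (Const c) = Const c"
| "lift k (M \<bullet> N) = lift k M \<bullet> lift k N"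
| "lift k (Lam s M) = Lam s (lift (Suc k) M)"

fun subst :: "tm \<Rightarrow> nat \<Rightarrow> tm \<Rightarrow> tm" where
  "subst N k (Var i) = (if i < k then Var i else if i = k then N else Var (i - 1))"
| "subst N k (Const c) = Const c"
| "subst N k (M \<bullet> M') = subst N k M \<bullet> subst N k M'"
| "subst N k (Lam s M) = Lam s (subst (lift 0 N) (Suc k) M)"

text \<open>In a well-typed redex the type annotations that ought to agree do so up to \<open>\<approx>\<close>. Those of
  the contractum are read off from the redex; in \<open>pcase_app\<close> the result type \<open>b\<close> is determined
  up to \<open>\<approx>\<close>.\<close>

inductive red :: "tm \<Rightarrow> tm \<Rightarrow> bool" where
  beta: "red (Lam s M \<bullet> N) (subst N 0 M)"
| case_0: "red (Const (Case s t r) \<bullet> (Const (In0 s' t') \<bullet> x) \<bullet> y \<bullet> z) (y \<bullet> x)"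
| case_1: "red (Const (Case s t r) \<bullet> (Const (In1 s' t') \<bullet> x) \<bullet> y \<bullet> z) (z \<bullet> x)"
| fst_pair: "red (Const (Fst s t) \<bullet> (Const (Pair s' t') \<bullet> x \<bullet> y)) x"
| snd_pair: "red (Const (Snd s t) \<bullet> (Const (Pair s' t') \<bullet> x \<bullet> y)) y"
| pcase_0: "red (Const (Pcase s t r) \<bullet> (Const (In0 s' t') \<bullet> x) \<bullet> y \<bullet> z) y"
| pcase_1: "red (Const (Pcase s t r) \<bullet> (Const (In1 s' t') \<bullet> x) \<bullet> y \<bullet> z) z"
| pcase_00: "red (Const (Pcase s t r) \<bullet> x \<bullet> (Const (In0 a b) \<bullet> y) \<bullet> (Const (In0 a' b') \<bullet> z))
                 (Const (In0 a b) \<bullet> (Const (Pcase s t a) \<bullet> x \<bullet> y \<bullet> z))"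
| pcase_11: "red (Const (Pcase s t r) \<bullet> x \<bullet> (Const (In1 a b) \<bullet> y) \<bullet> (Const (In1 a' b') \<bullet> z))
                 (Const (In1 a b) \<bullet> (Const (Pcase s t b) \<bullet> x \<bullet> y \<bullet> z))"
| pcase_pair: "red (Const (Pcase s t r) \<bullet> x \<bullet> (Const (Pair a b) \<bullet> y1 \<bullet> y2)
                                        \<bullet> (Const (Pair a' b') \<bullet> z1 \<bullet> z2))
                   (Const (Pair a b) \<bullet> (Const (Pcase s t a) \<bullet> x \<bullet> y1 \<bullet> z1)
                                     \<bullet> (Const (Pcase s t b) \<bullet> x \<bullet> y2 \<bullet> z2))"
| pcase_app: "r \<approx> TFun a b \<Longrightarrow> closed_ty a \<Longrightarrow> closed_ty b \<Longrightarrow>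
              red (Const (Pcase s t r) \<bullet> x \<bullet> y \<bullet> z \<bullet> w)
                  (Const (Pcase s t b) \<bullet> x \<bullet> (y \<bullet> w) \<bullet> (z \<bullet> w))"
| ctx_App1: "red M M' \<Longrightarrow> red (M \<bullet> N) (M' \<bullet> N)"
| ctx_App2: "red N N' \<Longrightarrow> red (M \<bullet> N) (M \<bullet> N')"
| ctx_Lam: "red M M' \<Longrightarrow> red (Lam s M) (Lam s M')"


section \<open>Prime systems\<close>

text \<open>One type of primes serves all types. \<open>Tag0\<close>, \<open>Tag1\<close>, \<open>Sum0 a\<close>, \<open>Sum1 b\<close> are the primes
  \<open>0\<close>, \<open>1\<close>, \<open>(0, a)\<close>, \<open>(1, b)\<close> of a sum; \<open>Left a\<close> and \<open>Right b\<close> are those of a product. \<open>Fn X b\<close> is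
  the step function that yields \<open>b\<close> on all arguments containing \<open>X\<close>.\<close>

datatype prime =
    Tag0
  | Tag1
  | Sum0 prime
  | Sum1 prime
  | Left prime
  | Right prime
  | Fn "prime fset" prime

record psys =
  primes :: "prime set"
  con :: "prime \<Rightarrow> prime \<Rightarrow> bool"
  le :: "prime \<Rightarrow> prime \<Rightarrow> bool"

text \<open>\<open>con\<close> and \<open>le\<close> are only meaningful on \<open>primes\<close>.\<close>

definition elements :: "psys \<Rightarrow> prime set set" where
  "elements A = {d. d \<subseteq> primes A \<and>
     (\<forall>a\<in>d. \<forall>b\<in>primes A. le A b a \<longrightarrow> b \<in> d) \<and>
     (\<forall>a\<in>d. \<forall>b\<in>d. con A a b)}"

text \<open>Finite consistent sets of primes, and the (isolated) elements that they generate. The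
  generated element is in general an infinite set.\<close>

definition fin_con :: "psys \<Rightarrow> prime fset \<Rightarrow> bool" where
  "fin_con A X \<longleftrightarrow> fset X \<subseteq> primes A \<and> (\<forall>a\<in>fset X. \<forall>b\<in>fset X. con A a b)"

definition down :: "psys \<Rightarrow> prime fset \<Rightarrow> prime set" where
  "down A X = {b \<in> primes A. \<exists>a\<in>fset X. le A b a}"

definition void_ps :: psys where
  "void_ps = \<lparr>primes = {}, con = (\<lambda>_ _. False), le = (\<lambda>_ _. False)\<rparr>"

fun sum_con :: "psys \<Rightarrow> psys \<Rightarrow> prime \<Rightarrow> prime \<Rightarrow> bool" where
  "sum_con A B Tag0 Tag0 \<longleftrightarrow> True"
| "sum_con A B Tag0 (Sum0 a) \<longleftrightarrow> True"
| "sum_con A B (Sum0 a) Tag0 \<longleftrightarrow> True"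
| "sum_con A B (Sum0 a) (Sum0 a') \<longleftrightarrow> con A a a'"
| "sum_con A B Tag1 Tag1 \<longleftrightarrow> True"
| "sum_con A B Tag1 (Sum1 b) \<longleftrightarrow> True"
| "sum_con A B (Sum1 b) Tag1 \<longleftrightarrow> True"
| "sum_con A B (Sum1 b) (Sum1 b') \<longleftrightarrow> con B b b'"
| "sum_con A B _ _ \<longleftrightarrow> False"

fun sum_le :: "psys \<Rightarrow> psys \<Rightarrow> prime \<Rightarrow> prime \<Rightarrow> bool" where
  "sum_le A B Tag0 Tag0 \<longleftrightarrow> True"
| "sum_le A B Tag0 (Sum0 a) \<longleftrightarrow> True"
| "sum_le A B (Sum0 a) (Sum0 a') \<longleftrightarrow> le A a a'"
| "sum_le A B Tag1 Tag1 \<longleftrightarrow> True"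
| "sum_le A B Tag1 (Sum1 b) \<longleftrightarrow> True"
| "sum_le A B (Sum1 b) (Sum1 b') \<longleftrightarrow> le B b b'"
| "sum_le A B _ _ \<longleftrightarrow> False"

definition sum_ps :: "psys \<Rightarrow> psys \<Rightarrow> psys" where
  "sum_ps A B = \<lparr>primes = {Tag0} \<union> Sum0 ` primes A \<union> {Tag1} \<union> Sum1 ` primes B,
                 con = sum_con A B, le = sum_le A B\<rparr>"

fun prod_con :: "psys \<Rightarrow> psys \<Rightarrow> prime \<Rightarrow> prime \<Rightarrow> bool" where
  "prod_con A B (Left a) (Left a') \<longleftrightarrow> con A a a'"
| "prod_con A B (Right b) (Right b') \<longleftrightarrow> con B b b'"
| "prod_con A B (Left a) (Right b) \<longleftrightarrow> True"
| "prod_con A B (Right b) (Left a) \<longleftrightarrow> True"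
| "prod_con A B _ _ \<longleftrightarrow> False"

fun prod_le :: "psys \<Rightarrow> psys \<Rightarrow> prime \<Rightarrow> prime \<Rightarrow> bool" where
  "prod_le A B (Left a) (Left a') \<longleftrightarrow> le A a a'"
| "prod_le A B (Right b) (Right b') \<longleftrightarrow> le B b b'"
| "prod_le A B _ _ \<longleftrightarrow> False"

definition prod_ps :: "psys \<Rightarrow> psys \<Rightarrow> psys" where
  "prod_ps A B = \<lparr>primes = Left ` primes A \<union> Right ` primes B,
                  con = prod_con A B, le = prod_le A B\<rparr>"

fun fun_con :: "psys \<Rightarrow> psys \<Rightarrow> prime \<Rightarrow> prime \<Rightarrow> bool" where
  "fun_con A B (Fn X a) (Fn Y b) \<longleftrightarrow>
     ((\<forall>x\<in>fset X. \<forall>y\<in>fset Y. con A x y) \<longrightarrow> con B a b)"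
| "fun_con A B _ _ \<longleftrightarrow> False"

fun fun_le :: "psys \<Rightarrow> psys \<Rightarrow> prime \<Rightarrow> prime \<Rightarrow> bool" where
  "fun_le A B (Fn X a) (Fn Y b) \<longleftrightarrow>
     (\<forall>y\<in>fset Y. \<exists>x\<in>fset X. le A y x) \<and> le B a b"
| "fun_le A B _ _ \<longleftrightarrow> False"

definition fun_ps :: "psys \<Rightarrow> psys \<Rightarrow> psys" where
  "fun_ps A B = \<lparr>primes = {Fn X b | X b. fin_con A X \<and> b \<in> primes B},
                 con = fun_con A B, le = fun_le A B\<rparr>"

text \<open>Finite prefixes of a type tree: subtrees below depth \<open>n\<close> are replaced by \<open>void\<close>.\<close>

datatype prefix =
    PVoid
  | PSum prefix prefix
  | PProd prefix prefix
  | PFun prefix prefix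

fun cut :: "nat \<Rightarrow> ty_tree \<Rightarrow> prefix" where
  "cut 0 T = PVoid"
| "cut (Suc n) T =
     (case T of
        NVoid \<Rightarrow> PVoid
      | NSum a b \<Rightarrow> PSum (cut n a) (cut n b)
      | NProd a b \<Rightarrow> PProd (cut n a) (cut n b)
      | NFun a b \<Rightarrow> PFun (cut n a) (cut n b))"

fun prefix_ps :: "prefix \<Rightarrow> psys" where
  "prefix_ps PVoid = void_ps"
| "prefix_ps (PSum a b) = sum_ps (prefix_ps a) (prefix_ps b)"
| "prefix_ps (PProd a b) = prod_ps (prefix_ps a) (prefix_ps b)"
| "prefix_ps (PFun a b) = fun_ps (prefix_ps a) (prefix_ps b)"

definition union_ps :: "(nat \<Rightarrow> psys) \<Rightarrow> psys" where
  "union_ps A =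
     \<lparr>primes = (\<Union>n. primes (A n)),
      con = (\<lambda>p q. \<exists>n. p \<in> primes (A n) \<and> q \<in> primes (A n) \<and> con (A n) p q),
      le = (\<lambda>p q. \<exists>n. p \<in> primes (A n) \<and> q \<in> primes (A n) \<and> le (A n) p q)\<rparr>"

definition ty_ps :: "ty \<Rightarrow> psys" where
  "ty_ps s = union_ps (\<lambda>n. prefix_ps (cut n (tree_of s)))"


section \<open>Denotations\<close>

text \<open>\<open>fn_abs A f\<close> is the element of the function space that represents the continuous function
  \<open>f\<close> on \<open>elements A\<close>; such an \<open>f\<close> is determined by its values on the isolated elements.\<close>

definition fn_abs :: "psys \<Rightarrow> (prime set \<Rightarrow> prime set) \<Rightarrow> prime set" where
  "fn_abs A f = {Fn X b | X b. fin_con A X \<and> b \<in> f (down A X)}"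

definition fn_app :: "prime set \<Rightarrow> prime set \<Rightarrow> prime set" where
  "fn_app f d = {b. \<exists>X. Fn X b \<in> f \<and> fset X \<subseteq> d}"

definition inj0 :: "prime set \<Rightarrow> prime set" where
  "inj0 d = {Tag0} \<union> Sum0 ` d"

definition inj1 :: "prime set \<Rightarrow> prime set" where
  "inj1 d = {Tag1} \<union> Sum1 ` d"

definition case_val :: "prime set \<Rightarrow> prime set \<Rightarrow> prime set \<Rightarrow> prime set" where
  "case_val s f g =
     (if Tag0 \<in> s then fn_app f {e. Sum0 e \<in> s}
      else if Tag1 \<in> s then fn_app g {e. Sum1 e \<in> s}
      else {})"

definition pcase_val :: "prime set \<Rightarrow> prime set \<Rightarrow> prime set \<Rightarrow> prime set" where
  "pcase_val s b c = (if Tag0 \<in> s then b else if Tag1 \<in> s then c else b \<inter> c)"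

definition pair_val :: "prime set \<Rightarrow> prime set \<Rightarrow> prime set" where
  "pair_val d e = Left ` d \<union> Right ` e"

definition fst_val :: "prime set \<Rightarrow> prime set" where
  "fst_val p = {a. Left a \<in> p}"

definition snd_val :: "prime set \<Rightarrow> prime set" where
  "snd_val p = {b. Right b \<in> p}"

fun const_sem :: "const \<Rightarrow> prime set" where
  "const_sem (In0 s t) = fn_abs (ty_ps s) inj0"
| "const_sem (In1 s t) = fn_abs (ty_ps t) inj1"
| "const_sem (Case s t r) =
     fn_abs (ty_ps (TSum s t)) (\<lambda>x. fn_abs (ty_ps (TFun s r)) (\<lambda>f.
       fn_abs (ty_ps (TFun t r)) (\<lambda>g. case_val x f g)))"
| "const_sem (Pcase s t r) =
     fn_abs (ty_ps (TSum s t)) (\<lambda>x. fn_abs (ty_ps r) (\<lambda>b.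
       fn_abs (ty_ps r) (\<lambda>c. pcase_val x b c)))"
| "const_sem (Pair s t) =
     fn_abs (ty_ps s) (\<lambda>d. fn_abs (ty_ps t) (\<lambda>e. pair_val d e))"
| "const_sem (Fst s t) = fn_abs (ty_ps (TProd s t)) fst_val"
| "const_sem (Snd s t) = fn_abs (ty_ps (TProd s t)) snd_val"
| "const_sem (Omega s) = {}"

fun sem :: "tm \<Rightarrow> (nat \<Rightarrow> prime set) \<Rightarrow> prime set" where
  "sem (Var i) e = e i"
| "sem (Const c) e = const_sem c"
| "sem (M \<bullet> N) e = fn_app (sem M e) (sem N e)"
| "sem (Lam s M) e = fn_abs (ty_ps s) (\<lambda>d. sem M (case_nat d e))"

text \<open>The denotation of a closed term does not depend on the environment.\<close>

definition den :: "tm \<Rightarrow> prime set" where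
  "den M = sem M (\<lambda>_. {})"


section \<open>Operational evaluation\<close>

text \<open>The values \<open>0 = {0}\<close>, \<open>1 = {1}\<close> and \<open>\<bottom> = {}\<close> of the domain of \<open>bool\<close>.\<close>

definition op_eval :: "tm \<Rightarrow> prime set" where
  "op_eval M =
     (if \<exists>s t M'. red\<^sup>*\<^sup>* M (Const (In0 s t) \<bullet> M') then {Tag0}
      else if \<exists>s t M'. red\<^sup>*\<^sup>* M (Const (In1 s t) \<bullet> M') then {Tag1}
      else {})"

end

theory Submission
  imports Defs
begin

text \<open>Reduction preserves denotations of well-typed terms, so \<open>M \<rightarrow>\<^sup>* 0M'\<close> forces \<open>den M = {0}\<close>.
  For the converse, primes are finite objects even at recursive types, hence a logical relation
  between terms and finite sets of primes can be defined by recursion on the size of the primes. A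
  term realizes a set of sum primes if it reduces to an injection whose argument realizes their
  components; a function realizes its step primes if it sends realizers of their (consistent)
  domains to realizers of their results. Realizability is closed under expansion and under passing
  to smaller primes, the rules for \<open>pcase\<close> are exactly what is needed to show that \<open>pcase\<close>
  realizes the intersection of its branches, and every term realizes all finite parts of its
  denotation.\<close>


section \<open>Primes without types\<close>

text \<open>Recursion may pass through the left of an arrow, so a logical relation cannot be set up
  by recursion on types. Recursion on primes is well-founded, but denotations are infinite sets of
  primes; continuity on the semantic side and \<open>adequate\<close> on the operational side pass
  between the two. Contravariance shapes the inductions that compare primes: in the argument
  position of a step prime the two sides change places, so the measures add up the sizes of
  everything compared. Types enter the semantics only through their trees, which makes conversion
  invisible there. Two places still call for type expressions. The rule for \<open>pcase\<close> at
  function type asks for closed \<open>a\<close> and \<open>b\<close> with the result type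
  equivalent to \<open>TFun a b\<close>; so realizability records that annotations of reducts are
  closed and have the right tree. And applying a denoted abstraction returns the expected value on
  points of its domain, which typing guarantees; so preservation of denotations is proved together
  with preservation of types.\<close>

lemma size_less_sum: "x \<in> fset X \<Longrightarrow> size x < (\<Sum>x\<in>fset X. Suc (size x))"
  using member_le_sum[of x "fset X" "\<lambda>x. Suc (size x)"] by simp

text \<open>The preceding sum is what \<open>X\<close> contributes to the size of
  \<open>Fn X b\<close>; it makes recursion through argument sets well-founded.\<close>

lemma size_prime_Fn: "x \<in> fset X \<Longrightarrow> size x < size (Fn X b)"
  using size_less_sum by fastforce

text \<open>The order and the consistency relation of all the prime systems are restrictions of two
  relations on primes that do not mention the type.\<close>

function (sequential) ple :: "prime \<Rightarrow> prime \<Rightarrow> bool" where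
  "ple Tag0 Tag0 \<longleftrightarrow> True"
| "ple Tag0 (Sum0 a) \<longleftrightarrow> True"
| "ple (Sum0 a) (Sum0 b) \<longleftrightarrow> ple a b"
| "ple Tag1 Tag1 \<longleftrightarrow> True"
| "ple Tag1 (Sum1 a) \<longleftrightarrow> True"
| "ple (Sum1 a) (Sum1 b) \<longleftrightarrow> ple a b"
| "ple (Left a) (Left b) \<longleftrightarrow> ple a b"
| "ple (Right a) (Right b) \<longleftrightarrow> ple a b"
| "ple (Fn X a) (Fn Y b) \<longleftrightarrow> (\<forall>y\<in>fset Y. \<exists>x\<in>fset X. ple y x) \<and> ple a b"
| "ple _ _ \<longleftrightarrow> False"
  by pat_completeness auto
termination
  by (relation "measure (\<lambda>(p, q). size p + size q)")
    (auto dest!: size_less_sum)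

function (sequential) pcon :: "prime \<Rightarrow> prime \<Rightarrow> bool" where
  "pcon Tag0 Tag0 \<longleftrightarrow> True"
| "pcon Tag0 (Sum0 a) \<longleftrightarrow> True"
| "pcon (Sum0 a) Tag0 \<longleftrightarrow> True"
| "pcon (Sum0 a) (Sum0 b) \<longleftrightarrow> pcon a b"
| "pcon Tag1 Tag1 \<longleftrightarrow> True"
| "pcon Tag1 (Sum1 a) \<longleftrightarrow> True"
| "pcon (Sum1 a) Tag1 \<longleftrightarrow> True"
| "pcon (Sum1 a) (Sum1 b) \<longleftrightarrow> pcon a b"
| "pcon (Left a) (Left b) \<longleftrightarrow> pcon a b"
| "pcon (Right a) (Right b) \<longleftrightarrow> pcon a b"
| "pcon (Left a) (Right b) \<longleftrightarrow> True"
| "pcon (Right a) (Left b) \<longleftrightarrow> True"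
| "pcon (Fn X a) (Fn Y b) \<longleftrightarrow> ((\<forall>x\<in>fset X. \<forall>y\<in>fset Y. pcon x y) \<longrightarrow> pcon a b)"
| "pcon _ _ \<longleftrightarrow> False"
  by pat_completeness auto
termination
  by (relation "measure (\<lambda>(p, q). size p + size q)")
    (auto dest!: size_less_sum)

lemma ple_refl [simp]: "ple p p"
  by (induction p) auto

lemma pcon_commute: "pcon p q \<longleftrightarrow> pcon q p"
proof (induction p q rule: pcon.induct)
  case (13 X a Y b)
  then have "(\<forall>x\<in>fset X. \<forall>y\<in>fset Y. pcon x y) \<longleftrightarrow> (\<forall>y\<in>fset Y. \<forall>x\<in>fset X. pcon y x)"
    by blast
  with 13(2) show ?case by (simp only: pcon.simps) blast
qed auto

text \<open>At step primes a chain from \<open>p\<close> over \<open>q\<close> to \<open>r\<close>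
  yields chains among the arguments in the reverse direction. The total size is insensitive to this
  reversal and decreases; the other cases go down one constructor.\<close>

lemma ple_trans: "ple p q \<Longrightarrow> ple q r \<Longrightarrow> ple p r"
proof (induction "size p + size q + size r" arbitrary: p q r rule: less_induct)
  case less
  show ?case
  proof (cases "\<exists>X a Y b Z c. p = Fn X a \<and> q = Fn Y b \<and> r = Fn Z c")
    case True
    then obtain X a Y b Z c where eq: "p = Fn X a" "q = Fn Y b" "r = Fn Z c" by blast
    have "\<exists>x\<in>fset X. ple z x" if z: "z \<in> fset Z" for z
    proof -
      obtain y where y: "y \<in> fset Y" "ple z y" using less.prems eq z by auto
      then obtain x where x: "x \<in> fset X" "ple y x" using less.prems eq by auto
      have "size z + size y + size x < size p + size q + size r"
        using size_prime_Fn[OF z, of c] size_prime_Fn[OF y(1), of b] size_prime_Fn[OF x(1), of a]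
        unfolding eq by linarith
      with less.hyps x y show ?thesis by blast
    qed
    moreover have "ple a c"
      using less.hyps[of a b c] less.prems eq by simp
    ultimately show ?thesis by (simp add: eq)
  next
    case False
    have hyp: "ple p' q' \<Longrightarrow> ple q' r' \<Longrightarrow> size p' + size q' + size r' < size p + size q + size r \<Longrightarrow>
      ple p' r'" for p' q' r' using less.hyps by blast
    show ?thesis using less.prems False
      by (cases p; cases q; simp; cases r; simp) (erule hyp, assumption, simp)+
  qed
qed

text \<open>For step primes the induction hypothesis is used twice: joint consistency of the
  arguments is pulled down from \<open>X'\<close>, \<open>Y'\<close> to \<open>X\<close>,
  \<open>Y\<close>, which lie below them, and consistency of the results from \<open>a\<close>,
  \<open>b\<close> to \<open>a'\<close>, \<open>b'\<close>.\<close>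

lemma pcon_mono: "pcon p q \<Longrightarrow> ple p' p \<Longrightarrow> ple q' q \<Longrightarrow> pcon p' q'"
proof (induction "size p + size q + size p' + size q'" arbitrary: p q p' q' rule: less_induct)
  case less
  show ?case
  proof (cases "\<exists>X a Y b. p = Fn X a \<and> q = Fn Y b")
    case True
    then obtain X a Y b where eq: "p = Fn X a" "q = Fn Y b" by blast
    with less.prems obtain X' a' Y' b' where eq': "p' = Fn X' a'" "q' = Fn Y' b'"
      by (cases p'; cases q') auto
    have "pcon a' b'" if con: "\<forall>x\<in>fset X'. \<forall>y\<in>fset Y'. pcon x y"
    proof -
      have "pcon x y" if x: "x \<in> fset X" and y: "y \<in> fset Y" for x y
      proof -
        obtain x' where x': "x' \<in> fset X'" "ple x x'" using less.prems(2) eq eq' x by auto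
        obtain y' where y': "y' \<in> fset Y'" "ple y y'" using less.prems(3) eq eq' y by auto
        have "size x' + size y' + size x + size y < size p + size q + size p' + size q'"
          using size_prime_Fn[OF x, of a] size_prime_Fn[OF x'(1), of a']
            size_prime_Fn[OF y, of b] size_prime_Fn[OF y'(1), of b']
          unfolding eq eq' by linarith
        with less.hyps con x' y' show ?thesis by blast
      qed
      then have "pcon a b" using less.prems(1) eq by auto
      then show ?thesis using less.hyps[of a b a' b'] less.prems(2,3) eq eq' by simp
    qed
    then show ?thesis by (simp add: eq')
  next
    case False
    have hyp: "pcon p1 q1 \<Longrightarrow> ple p2 p1 \<Longrightarrow> ple q2 q1 \<Longrightarrow>
      size p1 + size q1 + size p2 + size q2 < size p + size q + size p' + size q' \<Longrightarrow>
      pcon p2 q2" for p1 q1 p2 q2 using less.hyps by blast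
    show ?thesis using less.prems False
      by (cases p; cases q; simp; cases p'; simp; cases q'; simp) (erule hyp, assumption, assumption, simp)+
  qed
qed

definition consistent :: "prime set \<Rightarrow> bool" where
  "consistent d \<longleftrightarrow> (\<forall>a\<in>d. \<forall>b\<in>d. pcon a b)"

text \<open>The lower (Hoare) preorder on sets of primes. It stands in for inclusion between
  generated elements, which \<open>gen_mono\<close> recovers, so that finite sets can be compared
  without their infinite down-closures.\<close>

definition below :: "prime set \<Rightarrow> prime set \<Rightarrow> bool" where
  "below Y X \<longleftrightarrow> (\<forall>y\<in>Y. \<exists>x\<in>X. ple y x)"

lemma consistent_subset: "consistent d \<Longrightarrow> d' \<subseteq> d \<Longrightarrow> consistent d'"
  unfolding consistent_def by blast

lemma consistent_below: "consistent X \<Longrightarrow> below Y X \<Longrightarrow> consistent Y"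
  unfolding consistent_def below_def by (meson pcon_mono)

lemma below_subset: "Y \<subseteq> X \<Longrightarrow> below Y X"
  unfolding below_def using ple_refl by blast


section \<open>The prime system of a type tree\<close>

text \<open>Although the tree may be infinite, a prime inspects only finitely many of its nodes, so
  a least fixed point captures the primes of all finite prefixes at once.\<close>

inductive prime_of :: "ty_tree \<Rightarrow> prime \<Rightarrow> bool" where
  "prime_of (NSum A B) Tag0"
| "prime_of (NSum A B) Tag1"
| "prime_of A a \<Longrightarrow> prime_of (NSum A B) (Sum0 a)"
| "prime_of B b \<Longrightarrow> prime_of (NSum A B) (Sum1 b)"
| "prime_of A a \<Longrightarrow> prime_of (NProd A B) (Left a)"
| "prime_of B b \<Longrightarrow> prime_of (NProd A B) (Right b)"
| "(\<forall>x\<in>fset X. prime_of A x) \<Longrightarrow> consistent (fset X) \<Longrightarrow> prime_of B b \<Longrightarrow>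
     prime_of (NFun A B) (Fn X b)"

lemma prime_of_NVoid [simp]: "\<not> prime_of NVoid p"
  by (auto elim: prime_of.cases)

lemma prime_of_NSum [simp]:
  "prime_of (NSum A B) p \<longleftrightarrow> p = Tag0 \<or> p = Tag1 \<or> (\<exists>a. p = Sum0 a \<and> prime_of A a) \<or>
     (\<exists>b. p = Sum1 b \<and> prime_of B b)"
  by (auto elim: prime_of.cases intro: prime_of.intros)

lemma prime_of_NProd [simp]:
  "prime_of (NProd A B) p \<longleftrightarrow> (\<exists>a. p = Left a \<and> prime_of A a) \<or> (\<exists>b. p = Right b \<and> prime_of B b)"
  by (auto elim: prime_of.cases intro: prime_of.intros)

lemma prime_of_NFun [simp]:
  "prime_of (NFun A B) p \<longleftrightarrow> (\<exists>X b. p = Fn X b \<and> (\<forall>x\<in>fset X. prime_of A x) \<and>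
     consistent (fset X) \<and> prime_of B b)"
  by (auto elim: prime_of.cases intro: prime_of.intros)

text \<open>By \<open>primes_ty_ps\<close> and \<open>le_con_ty_ps\<close> these are the elements of
  the prime system \<open>ty_ps s\<close> when \<open>T\<close> is the tree of \<open>s\<close>.
  Likewise \<open>gen\<close> and \<open>tree_abs\<close> are \<open>down\<close> and
  \<open>fn_abs\<close> with the prefixes eliminated.\<close>

definition points :: "ty_tree \<Rightarrow> prime set set" where
  "points T = {d. (\<forall>a\<in>d. prime_of T a) \<and> (\<forall>a\<in>d. \<forall>b. prime_of T b \<longrightarrow> ple b a \<longrightarrow> b \<in> d) \<and>
     consistent d}"

definition gen :: "ty_tree \<Rightarrow> prime set \<Rightarrow> prime set" where
  "gen T X = {b. prime_of T b \<and> (\<exists>a\<in>X. ple b a)}"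

definition tree_abs :: "ty_tree \<Rightarrow> (prime set \<Rightarrow> prime set) \<Rightarrow> prime set" where
  "tree_abs T f = {Fn X b | X b. (\<forall>x\<in>fset X. prime_of T x) \<and> consistent (fset X) \<and>
     b \<in> f (gen T (fset X))}"

section \<open>Comparison with the prime systems of finite prefixes\<close>

abbreviation cut_ps :: "nat \<Rightarrow> ty_tree \<Rightarrow> psys" where
  "cut_ps n T \<equiv> prefix_ps (cut n T)"

lemma cut_ps_le_con:
  "p \<in> primes (cut_ps n T) \<Longrightarrow> q \<in> primes (cut_ps n T) \<Longrightarrow>
     (le (cut_ps n T) p q \<longleftrightarrow> ple p q) \<and> (con (cut_ps n T) p q \<longleftrightarrow> pcon p q)"
proof (induction n arbitrary: T p q)
  case 0
  then show ?case by (simp add: void_ps_def)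
next
  case (Suc n)
  show ?case
  proof (cases T)
    case NVoid
    then show ?thesis using Suc.prems by (simp add: void_ps_def)
  next
    case (NSum A B)
    then show ?thesis using Suc by (auto simp: sum_ps_def)
  next
    case (NProd A B)
    then show ?thesis using Suc by (auto simp: prod_ps_def)
  next
    case (NFun A B)
    with Suc.prems obtain X a Y b where eq: "p = Fn X a" "q = Fn Y b"
      and X: "fset X \<subseteq> primes (cut_ps n A)" and Y: "fset Y \<subseteq> primes (cut_ps n A)"
      and ab: "a \<in> primes (cut_ps n B)" "b \<in> primes (cut_ps n B)"
      by (auto simp: fun_ps_def fin_con_def)
    have "\<forall>x\<in>fset X. \<forall>y\<in>fset Y. (le (cut_ps n A) y x \<longleftrightarrow> ple y x) \<and> (con (cut_ps n A) x y \<longleftrightarrow> pcon x y)"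
      using Suc.IH X Y by blast
    with Suc.IH[OF ab] NFun eq show ?thesis by (simp add: fun_ps_def)
  qed
qed

lemma cut_ps_fin_con:
  "fin_con (cut_ps n T) X \<longleftrightarrow> fset X \<subseteq> primes (cut_ps n T) \<and> consistent (fset X)"
  unfolding fin_con_def consistent_def using cut_ps_le_con by blast

lemma cut_ps_prime_of: "p \<in> primes (cut_ps n T) \<Longrightarrow> prime_of T p"
proof (induction n arbitrary: T p)
  case 0
  then show ?case by (simp add: void_ps_def)
next
  case (Suc n)
  show ?case
  proof (cases T)
    case NVoid
    then show ?thesis using Suc.prems by (simp add: void_ps_def)
  next
    case (NSum A B)
    then show ?thesis using Suc by (auto simp: sum_ps_def)
  next
    case (NProd A B)
    then show ?thesis using Suc by (auto simp: prod_ps_def)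
  next
    case (NFun A B)
    then show ?thesis using Suc by (fastforce simp: fun_ps_def cut_ps_fin_con)
  qed
qed

lemma cut_ps_Suc: "primes (cut_ps n T) \<subseteq> primes (cut_ps (Suc n) T)"
proof (induction n arbitrary: T)
  case 0
  then show ?case by (simp add: void_ps_def)
next
  case (Suc n)
  show ?case
  proof (cases T)
    case NVoid
    then show ?thesis by (simp add: void_ps_def)
  next
    case (NSum A B)
    then show ?thesis using Suc[of A] Suc[of B]
      by (auto simp: sum_ps_def simp del: cut.simps(2) simp: cut.simps(2)[of _ "NSum _ _"])
  next
    case (NProd A B)
    then show ?thesis using Suc[of A] Suc[of B]
      by (auto simp: prod_ps_def simp del: cut.simps(2) simp: cut.simps(2)[of _ "NProd _ _"])
  next
    case (NFun A B)
    then show ?thesis using Suc[of A] Suc[of B]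
      by (auto simp: fun_ps_def cut_ps_fin_con simp del: cut.simps(2) simp: cut.simps(2)[of _ "NFun _ _"])
  qed
qed

lemma cut_ps_mono: "m \<le> n \<Longrightarrow> primes (cut_ps m T) \<subseteq> primes (cut_ps n T)"
  by (rule lift_Suc_mono_le[of "\<lambda>n. primes (cut_ps n T)"]) (rule cut_ps_Suc)

text \<open>The stages form a chain, so finitely many primes share the largest of their stages. This
  places the argument set of a step prime in a single stage.\<close>

lemma cut_ps_finite:
  assumes "finite X" "\<forall>x\<in>X. \<exists>n. x \<in> primes (cut_ps n T)"
  shows "\<exists>n. X \<subseteq> primes (cut_ps n T)"
proof -
  obtain k where k: "\<forall>x\<in>X. x \<in> primes (cut_ps (k x) T)" using assms(2) by metis
  have "x \<in> primes (cut_ps (Max (k ` X)) T)" if "x \<in> X" for x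
    using k that cut_ps_mono[of "k x" "Max (k ` X)" T] assms(1) by auto
  then show ?thesis by blast
qed

lemma prime_of_cut_ps: "prime_of T p \<Longrightarrow> \<exists>n. p \<in> primes (cut_ps n T)"
proof (induction rule: prime_of.induct)
  case (1 A B)
  have "Tag0 \<in> primes (cut_ps 1 (NSum A B))" by (simp add: sum_ps_def)
  then show ?case ..
next
  case (2 A B)
  have "Tag1 \<in> primes (cut_ps 1 (NSum A B))" by (simp add: sum_ps_def)
  then show ?case ..
next
  case (3 A a B)
  then obtain n where "a \<in> primes (cut_ps n A)" by blast
  then have "Sum0 a \<in> primes (cut_ps (Suc n) (NSum A B))" by (simp add: sum_ps_def)
  then show ?case ..
next
  case (4 B b A)
  then obtain n where "b \<in> primes (cut_ps n B)" by blast
  then have "Sum1 b \<in> primes (cut_ps (Suc n) (NSum A B))" by (simp add: sum_ps_def)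
  then show ?case ..
next
  case (5 A a B)
  then obtain n where "a \<in> primes (cut_ps n A)" by blast
  then have "Left a \<in> primes (cut_ps (Suc n) (NProd A B))" by (simp add: prod_ps_def)
  then show ?case ..
next
  case (6 B b A)
  then obtain n where "b \<in> primes (cut_ps n B)" by blast
  then have "Right b \<in> primes (cut_ps (Suc n) (NProd A B))" by (simp add: prod_ps_def)
  then show ?case ..
next
  case (7 X A B b)
  obtain m where m: "fset X \<subseteq> primes (cut_ps m A)" using cut_ps_finite 7 by (metis finite_fset)
  obtain n where n: "b \<in> primes (cut_ps n B)" using 7 by blast
  \<comment> \<open>Arguments and result may appear at different stages; both lie in the later
    one.\<close>
  have "fset X \<subseteq> primes (cut_ps (max m n) A)" "b \<in> primes (cut_ps (max m n) B)"
    using m n cut_ps_mono[of m "max m n" A] cut_ps_mono[of n "max m n" B] by auto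
  then have "Fn X b \<in> primes (cut_ps (Suc (max m n)) (NFun A B))"
    using 7 by (simp add: fun_ps_def cut_ps_fin_con)
  then show ?case ..
qed

lemma primes_ty_ps: "p \<in> primes (ty_ps s) \<longleftrightarrow> prime_of (tree_of s) p"
  unfolding ty_ps_def union_ps_def using prime_of_cut_ps cut_ps_prime_of by auto

lemma common_cut_ps:
  assumes "prime_of T p" "prime_of T q"
  obtains n where "p \<in> primes (cut_ps n T)" "q \<in> primes (cut_ps n T)"
  using cut_ps_finite[of "{p, q}" T] prime_of_cut_ps assms by auto

text \<open>The union relates two primes only inside a common stage; \<open>common_cut_ps\<close>
  supplies one for any two primes of the tree, and there the relations are the untyped ones.\<close>

lemma le_con_ty_ps:
  "(le (ty_ps s) p q \<longleftrightarrow> prime_of (tree_of s) p \<and> prime_of (tree_of s) q \<and> ple p q) \<and>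
   (con (ty_ps s) p q \<longleftrightarrow> prime_of (tree_of s) p \<and> prime_of (tree_of s) q \<and> pcon p q)"
proof (cases "prime_of (tree_of s) p \<and> prime_of (tree_of s) q")
  case True
  then obtain n where n: "p \<in> primes (cut_ps n (tree_of s))" "q \<in> primes (cut_ps n (tree_of s))"
    using common_cut_ps by blast
  then show ?thesis using True cut_ps_le_con[of p _ "tree_of s" q]
    by (simp add: ty_ps_def union_ps_def) blast
next
  case False
  then show ?thesis using cut_ps_prime_of[of _ _ "tree_of s"]
    by (simp add: ty_ps_def union_ps_def) blast
qed

lemmas le_ty_ps = le_con_ty_ps[THEN conjunct1] and con_ty_ps = le_con_ty_ps[THEN conjunct2]

text \<open>The bridge from the given semantics to trees: after this step prefixes and stages
  disappear from the proof, and equivalent types, having equal trees, have the same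
  abstractions.\<close>

lemma fn_abs_ty_ps: "fn_abs (ty_ps s) f = tree_abs (tree_of s) f"
proof -
  have fc: "fin_con (ty_ps s) X \<longleftrightarrow> (\<forall>x\<in>fset X. prime_of (tree_of s) x) \<and> consistent (fset X)" for X
    unfolding fin_con_def consistent_def using primes_ty_ps con_ty_ps by blast
  have "down (ty_ps s) X = gen (tree_of s) (fset X)" if "fin_con (ty_ps s) X" for X
    using that unfolding down_def gen_def fc primes_ty_ps le_ty_ps by blast
  then show ?thesis
    unfolding fn_abs_def tree_abs_def conj_assoc[symmetric] fc[symmetric] by auto
qed


section \<open>Points and their operations\<close>

lemma pointsI:
  "(\<And>a. a \<in> d \<Longrightarrow> prime_of T a) \<Longrightarrow> (\<And>a b. a \<in> d \<Longrightarrow> prime_of T b \<Longrightarrow> ple b a \<Longrightarrow> b \<in> d) \<Longrightarrow>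
   (\<And>a b. a \<in> d \<Longrightarrow> b \<in> d \<Longrightarrow> pcon a b) \<Longrightarrow> d \<in> points T"
  unfolding points_def consistent_def by blast

lemma points_prime_of: "d \<in> points T \<Longrightarrow> a \<in> d \<Longrightarrow> prime_of T a"
  unfolding points_def by blast

lemma points_down: "d \<in> points T \<Longrightarrow> a \<in> d \<Longrightarrow> prime_of T b \<Longrightarrow> ple b a \<Longrightarrow> b \<in> d"
  unfolding points_def by blast

lemma points_consistent: "d \<in> points T \<Longrightarrow> consistent d"
  unfolding points_def by blast

lemma points_pcon: "d \<in> points T \<Longrightarrow> a \<in> d \<Longrightarrow> b \<in> d \<Longrightarrow> pcon a b"
  unfolding points_def consistent_def by blast

lemma points_not_Tag1: "d \<in> points T \<Longrightarrow> Tag0 \<in> d \<Longrightarrow> Tag1 \<notin> d"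
  using points_pcon by fastforce

lemma empty_points [simp]: "{} \<in> points T"
  by (rule pointsI) auto

lemma gen_points: "consistent X \<Longrightarrow> gen T X \<in> points T"
  by (rule pointsI) (auto simp: gen_def consistent_def intro: ple_trans pcon_mono)

lemma gen_subset: "d \<in> points T \<Longrightarrow> X \<subseteq> d \<Longrightarrow> gen T X \<subseteq> d"
  unfolding gen_def using points_down by blast

lemma subset_gen: "(\<forall>x\<in>X. prime_of T x) \<Longrightarrow> X \<subseteq> gen T X"
  unfolding gen_def using ple_refl by blast

lemma gen_mono: "below X Y \<Longrightarrow> gen T X \<subseteq> gen T Y"
  unfolding gen_def below_def using ple_trans by blast

lemma fn_app_mono: "f \<subseteq> g \<Longrightarrow> d \<subseteq> e \<Longrightarrow> fn_app f d \<subseteq> fn_app g e"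
  unfolding fn_app_def by blast

lemma tree_abs_mono: "(\<And>d. d \<in> points T \<Longrightarrow> f d \<subseteq> g d) \<Longrightarrow> tree_abs T f \<subseteq> tree_abs T g"
  unfolding tree_abs_def using gen_points by blast

lemma fn_app_points:
  assumes f: "f \<in> points (NFun A B)" and d: "d \<in> points A"
  shows "fn_app f d \<in> points B"
proof (rule pointsI)
  fix a assume "a \<in> fn_app f d"
  then show "prime_of B a" using points_prime_of[OF f] by (auto simp: fn_app_def)
next
  fix a b assume "a \<in> fn_app f d" and b: "prime_of B b" "ple b a"
  then obtain X where X: "Fn X a \<in> f" "fset X \<subseteq> d" by (auto simp: fn_app_def)
  \<comment> \<open>Lowering the result of a step prime lowers the step prime, so \<open>f\<close>
    already contains it.\<close>
  then have "Fn X b \<in> f"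
    using points_down[OF f X(1), of "Fn X b"] points_prime_of[OF f X(1)] b by auto (use ple_refl in blast)
  then show "b \<in> fn_app f d" using X by (auto simp: fn_app_def)
next
  fix a b assume "a \<in> fn_app f d" "b \<in> fn_app f d"
  then obtain X Y where "Fn X a \<in> f" "fset X \<subseteq> d" "Fn Y b \<in> f" "fset Y \<subseteq> d"
    by (auto simp: fn_app_def)
  then show "pcon a b"
    using points_pcon[OF f, of "Fn X a" "Fn Y b"] points_pcon[OF d] by (simp add: subset_iff)
qed

definition mono_points :: "ty_tree \<Rightarrow> (prime set \<Rightarrow> prime set) \<Rightarrow> bool" where
  "mono_points A f \<longleftrightarrow> (\<forall>d\<in>points A. \<forall>e\<in>points A. d \<subseteq> e \<longrightarrow> f d \<subseteq> f e)"

text \<open>Continuity at \<open>d\<close> in finite terms. The sets \<open>e\<close> between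
  \<open>X\<close> and \<open>d\<close> are arbitrary, not only points; the upper bound makes sure
  that \<open>e\<close> carries no tag absent from \<open>d\<close>, since \<open>case_val\<close>
  and \<open>pcase_val\<close> branch on tags.\<close>

definition finitary :: "(prime set \<Rightarrow> prime set) \<Rightarrow> prime set \<Rightarrow> bool" where
  "finitary f d \<longleftrightarrow>
     (\<forall>b\<in>f d. \<exists>X. finite X \<and> X \<subseteq> d \<and> (\<forall>e. X \<subseteq> e \<longrightarrow> e \<subseteq> d \<longrightarrow> b \<in> f e))"

lemma mono_pointsD:
  "mono_points A f \<Longrightarrow> d \<in> points A \<Longrightarrow> e \<in> points A \<Longrightarrow> d \<subseteq> e \<Longrightarrow> f d \<subseteq> f e"
  unfolding mono_points_def by simp

text \<open>Two step primes of the abstraction whose argument sets are jointly consistent both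
  describe the value of \<open>f\<close> at the point generated by the union of these sets, so their
  results are consistent. Downward closure follows from monotonicity, since a smaller step prime has
  an argument set that is larger with respect to \<open>below\<close>.\<close>

lemma tree_abs_points:
  assumes f: "\<And>d. d \<in> points A \<Longrightarrow> f d \<in> points B" and mono: "mono_points A f"
  shows "tree_abs A f \<in> points (NFun A B)"
proof -
  have mono': "f (gen A X) \<subseteq> f (gen A Y)" if "consistent Y" "below X Y" for X Y
    using mono gen_points[OF consistent_below[OF that]] gen_points[OF that(1)] gen_mono[OF that(2)]
    by (rule mono_pointsD)
  show ?thesis
  proof (rule pointsI)
    fix p assume "p \<in> tree_abs A f"
    then show "prime_of (NFun A B) p"
      by (auto simp: tree_abs_def intro: points_prime_of[OF f[OF gen_points]])
  next
    fix p q assume p: "p \<in> tree_abs A f" and q: "prime_of (NFun A B) q" "ple q p"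
    from p obtain Y b where Y: "p = Fn Y b" "\<forall>y\<in>fset Y. prime_of A y" "consistent (fset Y)"
      "b \<in> f (gen A (fset Y))" by (auto simp: tree_abs_def)
    from q obtain X a where X: "q = Fn X a" "\<forall>x\<in>fset X. prime_of A x" "consistent (fset X)"
      "prime_of B a" by auto
    have "below (fset Y) (fset X)" "ple a b" using q(2) X Y by (auto simp: below_def)
    then have "b \<in> f (gen A (fset X))"
      using Y mono' X by blast
    then have "a \<in> f (gen A (fset X))"
      using points_down[OF f[OF gen_points]] X \<open>ple a b\<close> by blast
    then show "q \<in> tree_abs A f" using X by (auto simp: tree_abs_def)
  next
    fix p q assume "p \<in> tree_abs A f" "q \<in> tree_abs A f"
    then obtain X a Y b where X: "p = Fn X a" "consistent (fset X)" "a \<in> f (gen A (fset X))"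
      and Y: "q = Fn Y b" "consistent (fset Y)" "b \<in> f (gen A (fset Y))"
      by (auto simp: tree_abs_def)
    have "pcon a b" if "\<forall>x\<in>fset X. \<forall>y\<in>fset Y. pcon x y"
    proof -
      have "\<forall>x\<in>fset X. \<forall>y\<in>fset Y. pcon y x"
        using that by (subst pcon_commute)
      then have c: "consistent (fset X \<union> fset Y)"
        using that X(2) Y(2) unfolding consistent_def by blast
      have "a \<in> f (gen A (fset X \<union> fset Y))" "b \<in> f (gen A (fset X \<union> fset Y))"
        using mono'[OF c] X(3) Y(3) below_subset[OF Un_upper1] below_subset[OF Un_upper2] by blast+
      then show ?thesis using points_pcon[OF f[OF gen_points[OF c]]] by blast
    qed
    then show "pcon p q" using X Y by simp
  qed
qed

lemma finitaryE:
  assumes "finitary f d" "b \<in> f d"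
  obtains X where "finite X" "X \<subseteq> d" "\<And>e. X \<subseteq> e \<Longrightarrow> e \<subseteq> d \<Longrightarrow> b \<in> f e"
proof -
  have "\<exists>X. finite X \<and> X \<subseteq> d \<and> (\<forall>e. X \<subseteq> e \<longrightarrow> e \<subseteq> d \<longrightarrow> b \<in> f e)"
    using assms unfolding finitary_def by (rule bspec)
  then show ?thesis using that by (elim exE conjE) simp
qed

text \<open>The semantic \<beta>-law. Monotonicity gives one inclusion, because the point generated
  by a subset of \<open>d\<close> stays within \<open>d\<close>; for the other, a finite part of
  \<open>d\<close> that suffices for a prime becomes the argument set of a step prime.\<close>

lemma fn_app_tree_abs:
  assumes d: "d \<in> points A" and mono: "mono_points A f" and fin: "finitary f d"
  shows "fn_app (tree_abs A f) d = f d"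
proof
  show "fn_app (tree_abs A f) d \<subseteq> f d"
  proof
    fix b assume "b \<in> fn_app (tree_abs A f) d"
    then obtain X where X: "consistent (fset X)" "b \<in> f (gen A (fset X))" "fset X \<subseteq> d"
      by (auto simp: fn_app_def tree_abs_def)
    then show "b \<in> f d"
      using mono_pointsD[OF mono gen_points[OF X(1)] d gen_subset[OF d X(3)]] by (simp add: subset_iff)
  qed
next
  show "f d \<subseteq> fn_app (tree_abs A f) d"
  proof
    fix b assume "b \<in> f d"
    with fin obtain X' where X': "finite X'" "X' \<subseteq> d" "\<And>e. X' \<subseteq> e \<Longrightarrow> e \<subseteq> d \<Longrightarrow> b \<in> f e"
      by (rule finitaryE) (rule that)
    define X where "X = Abs_fset X'"
    have "fset X = X'" using X'(1) by (simp add: X_def Abs_fset_inverse)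
    then have X: "fset X \<subseteq> d" "\<And>e. fset X \<subseteq> e \<Longrightarrow> e \<subseteq> d \<Longrightarrow> b \<in> f e"
      using X' by simp_all
    have p: "\<forall>x\<in>fset X. prime_of A x" using X d points_prime_of by blast
    then have "b \<in> f (gen A (fset X))"
      using X(2)[OF subset_gen gen_subset[OF d X(1)]] by simp
    moreover have "consistent (fset X)" using X d points_consistent consistent_subset by blast
    ultimately show "b \<in> fn_app (tree_abs A f) d"
      using X(1) p by (auto simp: fn_app_def tree_abs_def)
  qed
qed


section \<open>Continuous functions and the operations behind the constants\<close>

definition contin :: "ty_tree \<Rightarrow> ty_tree \<Rightarrow> (prime set \<Rightarrow> prime set) \<Rightarrow> bool" where
  "contin A B f \<longleftrightarrow> (\<forall>d\<in>points A. f d \<in> points B) \<and> mono_points A f \<and> (\<forall>d\<in>points A. finitary f d)"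

lemma continI:
  assumes "\<And>d. d \<in> points A \<Longrightarrow> f d \<in> points B"
    and "\<And>d e. d \<in> points A \<Longrightarrow> e \<in> points A \<Longrightarrow> d \<subseteq> e \<Longrightarrow> f d \<subseteq> f e"
    and "\<And>d b. d \<in> points A \<Longrightarrow> b \<in> f d \<Longrightarrow>
      \<exists>X. finite X \<and> X \<subseteq> d \<and> (\<forall>e. X \<subseteq> e \<longrightarrow> e \<subseteq> d \<longrightarrow> b \<in> f e)"
  shows "contin A B f"
  using assms unfolding contin_def mono_points_def finitary_def by simp

lemma contin_points: "contin A B f \<Longrightarrow> tree_abs A f \<in> points (NFun A B)"
  unfolding contin_def by (simp add: tree_abs_points)

lemma contin_app: "contin A B f \<Longrightarrow> d \<in> points A \<Longrightarrow> fn_app (tree_abs A f) d = f d"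
  unfolding contin_def by (simp add: fn_app_tree_abs)

text \<open>Currying: separate continuity in both variables suffices. Membership of a step prime
  \<open>Fn Y b\<close> in \<open>tree_abs B (F d)\<close> depends on \<open>F d\<close> at the
  single point generated by \<open>Y\<close>, so a finite part of \<open>d\<close> for that one
  value will do.\<close>

lemma contin_abs:
  assumes 1: "\<And>y. y \<in> points B \<Longrightarrow> contin A C (\<lambda>x. F x y)"
    and 2: "\<And>x. x \<in> points A \<Longrightarrow> contin B C (F x)"
  shows "contin A (NFun B C) (\<lambda>x. tree_abs B (F x))"
proof (rule continI)
  show "tree_abs B (F d) \<in> points (NFun B C)" if "d \<in> points A" for d
    using contin_points[OF 2[OF that]] .
  show "tree_abs B (F d) \<subseteq> tree_abs B (F e)" if "d \<in> points A" "e \<in> points A" "d \<subseteq> e" for d e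
  proof (rule tree_abs_mono)
    fix y assume "y \<in> points B"
    then have "mono_points A (\<lambda>x. F x y)" using 1 unfolding contin_def by simp
    then show "F d y \<subseteq> F e y" using that by (rule mono_pointsD)
  qed
  show "\<exists>X. finite X \<and> X \<subseteq> d \<and> (\<forall>e. X \<subseteq> e \<longrightarrow> e \<subseteq> d \<longrightarrow> p \<in> tree_abs B (F e))"
    if d: "d \<in> points A" and p: "p \<in> tree_abs B (F d)" for d p
  proof -
    from p obtain Y b where Y: "p = Fn Y b" "\<forall>x\<in>fset Y. prime_of B x" "consistent (fset Y)"
      "b \<in> F d (gen B (fset Y))" by (auto simp: tree_abs_def)
    have "finitary (\<lambda>x. F x (gen B (fset Y))) d"
      using 1[OF gen_points[OF Y(3)]] d unfolding contin_def by simp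
    then obtain X where X: "finite X" "X \<subseteq> d"
      "\<And>e. X \<subseteq> e \<Longrightarrow> e \<subseteq> d \<Longrightarrow> b \<in> F e (gen B (fset Y))"
      using Y(4) by (rule finitaryE) (rule that)
    then have "\<forall>e. X \<subseteq> e \<longrightarrow> e \<subseteq> d \<longrightarrow> p \<in> tree_abs B (F e)"
      using Y by (auto simp: tree_abs_def)
    with X show ?thesis by blast
  qed
qed

lemma inj0_points: "d \<in> points A \<Longrightarrow> inj0 d \<in> points (NSum A B)"
  by (rule pointsI) (auto simp: inj0_def image_iff intro: points_prime_of points_down points_pcon)

lemma inj1_points: "d \<in> points B \<Longrightarrow> inj1 d \<in> points (NSum A B)"
  by (rule pointsI) (auto simp: inj1_def image_iff intro: points_prime_of points_down points_pcon)

lemma pair_val_points: "d \<in> points A \<Longrightarrow> e \<in> points B \<Longrightarrow> pair_val d e \<in> points (NProd A B)"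
  by (rule pointsI) (auto simp: pair_val_def image_iff intro: points_prime_of points_down points_pcon)

lemma Sum0_points:
  assumes "x \<in> points (NSum A B)"
  shows "{a. Sum0 a \<in> x} \<in> points A"
proof (rule pointsI)
  show "prime_of A a" if "a \<in> {a. Sum0 a \<in> x}" for a
    using points_prime_of[OF assms, of "Sum0 a"] that by simp
  show "b \<in> {a. Sum0 a \<in> x}" if "a \<in> {a. Sum0 a \<in> x}" "prime_of A b" "ple b a" for a b
    using points_down[OF assms, of "Sum0 a" "Sum0 b"] that by simp
  show "pcon a b" if "a \<in> {a. Sum0 a \<in> x}" "b \<in> {a. Sum0 a \<in> x}" for a b
    using points_pcon[OF assms, of "Sum0 a" "Sum0 b"] that by simp
qed

lemma Sum1_points:
  assumes "x \<in> points (NSum A B)"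
  shows "{b. Sum1 b \<in> x} \<in> points B"
proof (rule pointsI)
  show "prime_of B a" if "a \<in> {a. Sum1 a \<in> x}" for a
    using points_prime_of[OF assms, of "Sum1 a"] that by simp
  show "b \<in> {a. Sum1 a \<in> x}" if "a \<in> {a. Sum1 a \<in> x}" "prime_of B b" "ple b a" for a b
    using points_down[OF assms, of "Sum1 a" "Sum1 b"] that by simp
  show "pcon a b" if "a \<in> {a. Sum1 a \<in> x}" "b \<in> {a. Sum1 a \<in> x}" for a b
    using points_pcon[OF assms, of "Sum1 a" "Sum1 b"] that by simp
qed

lemma fst_val_points:
  assumes "x \<in> points (NProd A B)"
  shows "fst_val x \<in> points A"
proof (rule pointsI)
  show "prime_of A a" if "a \<in> fst_val x" for a
    using points_prime_of[OF assms, of "Left a"] that by (simp add: fst_val_def)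
  show "b \<in> fst_val x" if "a \<in> fst_val x" "prime_of A b" "ple b a" for a b
    using points_down[OF assms, of "Left a" "Left b"] that by (simp add: fst_val_def)
  show "pcon a b" if "a \<in> fst_val x" "b \<in> fst_val x" for a b
    using points_pcon[OF assms, of "Left a" "Left b"] that by (simp add: fst_val_def)
qed

lemma snd_val_points:
  assumes "x \<in> points (NProd A B)"
  shows "snd_val x \<in> points B"
proof (rule pointsI)
  show "prime_of B a" if "a \<in> snd_val x" for a
    using points_prime_of[OF assms, of "Right a"] that by (simp add: snd_val_def)
  show "b \<in> snd_val x" if "a \<in> snd_val x" "prime_of B b" "ple b a" for a b
    using points_down[OF assms, of "Right a" "Right b"] that by (simp add: snd_val_def)
  show "pcon a b" if "a \<in> snd_val x" "b \<in> snd_val x" for a b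
    using points_pcon[OF assms, of "Right a" "Right b"] that by (simp add: snd_val_def)
qed

lemma case_val_points:
  "x \<in> points (NSum A B) \<Longrightarrow> f \<in> points (NFun A C) \<Longrightarrow> g \<in> points (NFun B C) \<Longrightarrow>
   case_val x f g \<in> points C"
  unfolding case_val_def by (simp add: fn_app_points Sum0_points Sum1_points)

lemma Int_points: "b \<in> points C \<Longrightarrow> c \<in> points C \<Longrightarrow> b \<inter> c \<in> points C"
  by (rule pointsI) (auto intro: points_prime_of points_down points_pcon)

lemma pcase_val_points: "b \<in> points C \<Longrightarrow> c \<in> points C \<Longrightarrow> pcase_val x b c \<in> points C"
  unfolding pcase_val_def by (simp add: Int_points)

lemma contin_inj0: "contin A (NSum A B) inj0"
proof (rule continI)
  fix d b assume "b \<in> inj0 d"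
  then show "\<exists>X. finite X \<and> X \<subseteq> d \<and> (\<forall>e. X \<subseteq> e \<longrightarrow> e \<subseteq> d \<longrightarrow> b \<in> inj0 e)"
    \<comment> \<open>Empty if \<open>b\<close> is \<open>Tag0\<close>, otherwise the singleton of
      the component of \<open>b\<close>.\<close>
    by (intro exI[of _ "{a. b = Sum0 a}"]) (cases b; auto simp: inj0_def)
qed (auto simp: inj0_points, auto simp: inj0_def)

lemma contin_inj1: "contin B (NSum A B) inj1"
proof (rule continI)
  fix d b assume "b \<in> inj1 d"
  then show "\<exists>X. finite X \<and> X \<subseteq> d \<and> (\<forall>e. X \<subseteq> e \<longrightarrow> e \<subseteq> d \<longrightarrow> b \<in> inj1 e)"
    by (intro exI[of _ "{a. b = Sum1 a}"]) (cases b; auto simp: inj1_def)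
qed (auto simp: inj1_points, auto simp: inj1_def)

lemma contin_pair_val1:
  assumes "e \<in> points B"
  shows "contin A (NProd A B) (\<lambda>d. pair_val d e)"
proof (rule continI)
  fix d b assume "b \<in> pair_val d e"
  then show "\<exists>X. finite X \<and> X \<subseteq> d \<and> (\<forall>d'. X \<subseteq> d' \<longrightarrow> d' \<subseteq> d \<longrightarrow> b \<in> pair_val d' e)"
    by (intro exI[of _ "{a. b = Left a}"]) (cases b; auto simp: pair_val_def)
qed (auto simp: pair_val_points assms, auto simp: pair_val_def)

lemma contin_pair_val2:
  assumes "d \<in> points A"
  shows "contin B (NProd A B) (pair_val d)"
proof (rule continI)
  fix e b assume "b \<in> pair_val d e"
  then show "\<exists>X. finite X \<and> X \<subseteq> e \<and> (\<forall>e'. X \<subseteq> e' \<longrightarrow> e' \<subseteq> e \<longrightarrow> b \<in> pair_val d e')"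
    by (intro exI[of _ "{a. b = Right a}"]) (cases b; auto simp: pair_val_def)
qed (auto simp: pair_val_points assms, auto simp: pair_val_def)

lemma contin_fst_val: "contin (NProd A B) A fst_val"
proof (rule continI)
  fix d b assume "b \<in> fst_val d"
  then show "\<exists>X. finite X \<and> X \<subseteq> d \<and> (\<forall>e. X \<subseteq> e \<longrightarrow> e \<subseteq> d \<longrightarrow> b \<in> fst_val e)"
    by (intro exI[of _ "{Left b}"]) (auto simp: fst_val_def)
qed (auto simp: fst_val_points, auto simp: fst_val_def)

lemma contin_snd_val: "contin (NProd A B) B snd_val"
proof (rule continI)
  fix d b assume "b \<in> snd_val d"
  then show "\<exists>X. finite X \<and> X \<subseteq> d \<and> (\<forall>e. X \<subseteq> e \<longrightarrow> e \<subseteq> d \<longrightarrow> b \<in> snd_val e)"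
    by (intro exI[of _ "{Right b}"]) (auto simp: snd_val_def)
qed (auto simp: snd_val_points, auto simp: snd_val_def)

lemma fn_app_finite_fun: "b \<in> fn_app f d \<Longrightarrow> \<exists>X. finite X \<and> X \<subseteq> f \<and> (\<forall>e. X \<subseteq> e \<longrightarrow> b \<in> fn_app e d)"
proof -
  assume "b \<in> fn_app f d"
  then obtain X where "Fn X b \<in> f" "fset X \<subseteq> d" unfolding fn_app_def by blast
  then show ?thesis by (intro exI[of _ "{Fn X b}"]) (auto simp: fn_app_def)
qed

lemma contin_case_val2:
  assumes x: "x \<in> points (NSum A B)" and g: "g \<in> points (NFun B C)"
  shows "contin (NFun A C) C (\<lambda>f. case_val x f g)"
proof (rule continI)
  show "case_val x f g \<in> points C" if "f \<in> points (NFun A C)" for f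
    using x g that by (simp add: case_val_points)
  show "case_val x d g \<subseteq> case_val x e g" if "d \<subseteq> e" for d e
    by (simp add: case_val_def fn_app_mono[OF that])
  show "\<exists>X. finite X \<and> X \<subseteq> d \<and> (\<forall>e. X \<subseteq> e \<longrightarrow> e \<subseteq> d \<longrightarrow> b \<in> case_val x e g)"
    if "b \<in> case_val x d g" for b d
  proof (cases "Tag0 \<in> x")
    case True
    then have "b \<in> fn_app d {a. Sum0 a \<in> x}" using that by (simp add: case_val_def)
    from fn_app_finite_fun[OF this] obtain X where "finite X" "X \<subseteq> d"
      "\<forall>e. X \<subseteq> e \<longrightarrow> b \<in> fn_app e {a. Sum0 a \<in> x}" by (elim exE conjE)
    then show ?thesis using True by (intro exI[of _ X]) (simp add: case_val_def)
  next
    case False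
    then show ?thesis using that by (intro exI[of _ "{}"]) (simp add: case_val_def)
  qed
qed

lemma contin_case_val3:
  assumes x: "x \<in> points (NSum A B)" and f: "f \<in> points (NFun A C)"
  shows "contin (NFun B C) C (case_val x f)"
proof (rule continI)
  show "case_val x f g \<in> points C" if "g \<in> points (NFun B C)" for g
    using x f that by (simp add: case_val_points)
  show "case_val x f d \<subseteq> case_val x f e" if "d \<subseteq> e" for d e
    by (simp add: case_val_def fn_app_mono[OF that])
  show "\<exists>X. finite X \<and> X \<subseteq> d \<and> (\<forall>e. X \<subseteq> e \<longrightarrow> e \<subseteq> d \<longrightarrow> b \<in> case_val x f e)"
    if "b \<in> case_val x f d" for b d
  proof (cases "Tag0 \<notin> x \<and> Tag1 \<in> x")
    case True
    then have "b \<in> fn_app d {a. Sum1 a \<in> x}" using that by (simp add: case_val_def)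
    from fn_app_finite_fun[OF this] obtain X where "finite X" "X \<subseteq> d"
      "\<forall>e. X \<subseteq> e \<longrightarrow> b \<in> fn_app e {a. Sum1 a \<in> x}" by (elim exE conjE)
    then show ?thesis using True by (intro exI[of _ X]) (simp add: case_val_def)
  next
    case False
    then show ?thesis using that by (intro exI[of _ "{}"]) (auto simp: case_val_def)
  qed
qed

text \<open>Consistency of points keeps the branching monotone: a point above one with
  \<open>Tag1\<close> cannot acquire \<open>Tag0\<close>. A sufficient finite part of the scrutinee
  consists of the tag and the components that the branch consumes.\<close>

lemma contin_case_val1:
  assumes f: "f \<in> points (NFun A C)" and g: "g \<in> points (NFun B C)"
  shows "contin (NSum A B) C (\<lambda>x. case_val x f g)"
proof (rule continI)
  show "case_val x f g \<in> points C" if "x \<in> points (NSum A B)" for x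
    using f g that by (simp add: case_val_points)
  show "case_val d f g \<subseteq> case_val e f g"
    if "d \<in> points (NSum A B)" "e \<in> points (NSum A B)" "d \<subseteq> e" for d e
  proof -
    have "{a. Sum0 a \<in> d} \<subseteq> {a. Sum0 a \<in> e}" "{a. Sum1 a \<in> d} \<subseteq> {a. Sum1 a \<in> e}" using that by auto
    then have "fn_app f {a. Sum0 a \<in> d} \<subseteq> fn_app f {a. Sum0 a \<in> e}"
      "fn_app g {a. Sum1 a \<in> d} \<subseteq> fn_app g {a. Sum1 a \<in> e}"
      by (simp_all add: fn_app_mono)
    then show ?thesis
      using points_not_Tag1[OF that(2)] that(3) by (auto simp: case_val_def)
  qed
  show "\<exists>X. finite X \<and> X \<subseteq> d \<and> (\<forall>e. X \<subseteq> e \<longrightarrow> e \<subseteq> d \<longrightarrow> b \<in> case_val e f g)"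
    if b: "b \<in> case_val d f g" for b d
  proof -
    consider "Tag0 \<in> d" | "Tag0 \<notin> d" "Tag1 \<in> d"
      using b by (auto simp: case_val_def split: if_splits)
    then show ?thesis
    proof cases
      case 1
      then obtain X where X: "Fn X b \<in> f" "Sum0 ` fset X \<subseteq> d"
        using b by (auto simp: case_val_def fn_app_def)
      have "b \<in> case_val e f g" if e: "insert Tag0 (Sum0 ` fset X) \<subseteq> e" for e
      proof -
        have "fset X \<subseteq> {a. Sum0 a \<in> e}" using e by auto
        then show ?thesis using X(1) e by (auto simp: case_val_def fn_app_def)
      qed
      then show ?thesis using X(2) 1 by (intro exI[of _ "insert Tag0 (Sum0 ` fset X)"]) auto
    next
      case 2
      then obtain X where X: "Fn X b \<in> g" "Sum1 ` fset X \<subseteq> d"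
        using b by (auto simp: case_val_def fn_app_def)
      have "b \<in> case_val e f g" if e: "insert Tag1 (Sum1 ` fset X) \<subseteq> e" "e \<subseteq> d" for e
      proof -
        \<comment> \<open>Here the bound \<open>e \<subseteq> d\<close> excludes
          \<open>Tag0\<close>, which would select the other branch.\<close>
        have "fset X \<subseteq> {a. Sum1 a \<in> e}" "Tag0 \<notin> e" using e 2 by auto
        then show ?thesis using X(1) e by (auto simp: case_val_def fn_app_def)
      qed
      then show ?thesis using X(2) 2 by (intro exI[of _ "insert Tag1 (Sum1 ` fset X)"]) auto
    qed
  qed
qed

lemma contin_pcase_val1:
  assumes "b \<in> points C" "c \<in> points C"
  shows "contin (NSum A B) C (\<lambda>x. pcase_val x b c)"
proof (rule continI)
  show "pcase_val d b c \<subseteq> pcase_val e b c"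
    if "d \<in> points (NSum A B)" "e \<in> points (NSum A B)" "d \<subseteq> e" for d e
    using points_not_Tag1[OF that(2)] that(3) by (auto simp: pcase_val_def)
  show "\<exists>X. finite X \<and> X \<subseteq> d \<and> (\<forall>e. X \<subseteq> e \<longrightarrow> e \<subseteq> d \<longrightarrow> p \<in> pcase_val e b c)"
    if "p \<in> pcase_val d b c" for p d
    \<comment> \<open>With this choice \<open>e\<close> has exactly the tags of \<open>d\<close>, so
      both values take the same branch.\<close>
    using that by (intro exI[of _ "d \<inter> {Tag0, Tag1}"]) (auto simp: pcase_val_def split: if_splits)
qed (simp add: pcase_val_points assms)

lemma contin_pcase_val2:
  assumes "c \<in> points C"
  shows "contin C C (\<lambda>b. pcase_val x b c)"
proof (rule continI)
  show "\<exists>X. finite X \<and> X \<subseteq> d \<and> (\<forall>e. X \<subseteq> e \<longrightarrow> e \<subseteq> d \<longrightarrow> p \<in> pcase_val x e c)"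
    if "p \<in> pcase_val x d c" for p d
    using that by (intro exI[of _ "d \<inter> {p}"]) (auto simp: pcase_val_def split: if_splits)
qed (simp add: pcase_val_points assms, auto simp: pcase_val_def split: if_splits)

lemma contin_pcase_val3:
  assumes "b \<in> points C"
  shows "contin C C (pcase_val x b)"
proof (rule continI)
  show "\<exists>X. finite X \<and> X \<subseteq> d \<and> (\<forall>e. X \<subseteq> e \<longrightarrow> e \<subseteq> d \<longrightarrow> p \<in> pcase_val x b e)"
    if "p \<in> pcase_val x b d" for p d
    using that by (intro exI[of _ "d \<inter> {p}"]) (auto simp: pcase_val_def split: if_splits)
qed (simp add: pcase_val_points assms, auto simp: pcase_val_def split: if_splits)

lemmas contin_pair = contin_abs[OF contin_pair_val1 contin_pair_val2]

lemmas contin_case2 = contin_abs[OF contin_case_val2 contin_case_val3]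

lemma contin_case1:
  "contin (NSum A B) (NFun (NFun A C) (NFun (NFun B C) C))
     (\<lambda>x. tree_abs (NFun A C) (\<lambda>f. tree_abs (NFun B C) (case_val x f)))"
  by (intro contin_abs contin_case_val1 contin_case_val2 contin_case_val3)

lemma contin_pcase1:
  "contin (NSum A B) (NFun C (NFun C C)) (\<lambda>x. tree_abs C (\<lambda>b. tree_abs C (pcase_val x b)))"
  by (intro contin_abs contin_pcase_val1 contin_pcase_val2 contin_pcase_val3)

lemma contin_pcase2: "contin C (NFun C C) (\<lambda>b. tree_abs C (pcase_val x b))"
  by (intro contin_abs contin_pcase_val2 contin_pcase_val3)


section \<open>Type trees and subject reduction\<close>

lemma ty_unfold_iff: "ty_unfold s t \<longleftrightarrow> (\<exists>a. s = TMu a \<and> t = ty_subst (TMu a) 0 a)"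
  by (auto elim: ty_unfold.cases intro: ty_unfold.intros)

lemma ty_unfold_normal: "ty_unfold\<^sup>*\<^sup>* s t \<Longrightarrow> \<nexists>a. s = TMu a \<Longrightarrow> t = s"
  by (erule converse_rtranclpE) (auto simp: ty_unfold_iff)

lemma ty_unfold_unique:
  "ty_unfold\<^sup>*\<^sup>* s t \<Longrightarrow> \<nexists>a. t = TMu a \<Longrightarrow> ty_unfold\<^sup>*\<^sup>* s t' \<Longrightarrow> \<nexists>a. t' = TMu a \<Longrightarrow> t = t'"
proof (induction rule: converse_rtranclp_induct)
  case base
  then show ?case using ty_unfold_normal by blast
next
  case (step s u)
  then have "s \<noteq> t'" by (auto simp: ty_unfold_iff)
  with step.prems obtain u' where "ty_unfold s u'" "ty_unfold\<^sup>*\<^sup>* u' t'"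
    by (auto elim: converse_rtranclpE)
  moreover have "u' = u" using step.hyps(1) \<open>ty_unfold s u'\<close> by (auto simp: ty_unfold_iff)
  ultimately show ?case using step by blast
qed

lemma ty_head_eq: "ty_unfold\<^sup>*\<^sup>* s t \<Longrightarrow> \<nexists>a. t = TMu a \<Longrightarrow> ty_head s = t"
  unfolding ty_head_def using ty_unfold_unique by (subst if_P) (blast intro!: the_equality)+

text \<open>The second alternative covers the default for roots that unfold forever, such as
  \<mu>t.t; being closed, it does no harm in \<open>closed_ty_head\<close>.\<close>

lemma ty_head_cases: "ty_unfold\<^sup>*\<^sup>* s (ty_head s) \<or> ty_head s = TVoid"
proof (cases "\<exists>t. ty_unfold\<^sup>*\<^sup>* s t \<and> \<not> (\<exists>a. t = TMu a)")
  case True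
  then obtain t where t: "ty_unfold\<^sup>*\<^sup>* s t" "\<nexists>a. t = TMu a" by blast
  from ty_head_eq[OF t] t(1) show ?thesis by simp
next
  case False
  then have "ty_head s = TVoid" unfolding ty_head_def by (rule if_not_P)
  then show ?thesis ..
qed

lemma tree_of_simps [simp]:
  "tree_of (TSum a b) = NSum (tree_of a) (tree_of b)"
  "tree_of (TProd a b) = NProd (tree_of a) (tree_of b)"
  "tree_of (TFun a b) = NFun (tree_of a) (tree_of b)"
  "tree_of TVoid = NVoid"
  using ty_head_eq[OF rtranclp.rtrancl_refl] by (subst tree_of.code; simp)+

lemma ty_free_below_lift: "ty_free_below k s \<Longrightarrow> ty_free_below (Suc k) (ty_lift j s)"
  by (induction s arbitrary: j k) auto

lemma ty_free_below_subst:
  "ty_free_below (Suc k) a \<Longrightarrow> ty_free_below k s \<Longrightarrow> ty_free_below k (ty_subst s k a)"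
  by (induction a arbitrary: s k) (auto simp: ty_free_below_lift)

lemma closed_ty_unfold: "ty_unfold\<^sup>*\<^sup>* s t \<Longrightarrow> closed_ty s \<Longrightarrow> closed_ty t"
  by (induction rule: rtranclp_induct)
    (auto simp: closed_ty_def ty_unfold_iff intro: ty_free_below_subst)

lemma closed_ty_head: "closed_ty s \<Longrightarrow> closed_ty (ty_head s)"
  using ty_head_cases[of s] closed_ty_unfold by (auto simp: closed_ty_def)

lemma closed_ty_simps [simp]:
  "closed_ty (TSum a b) \<longleftrightarrow> closed_ty a \<and> closed_ty b"
  "closed_ty (TProd a b) \<longleftrightarrow> closed_ty a \<and> closed_ty b"
  "closed_ty (TFun a b) \<longleftrightarrow> closed_ty a \<and> closed_ty b"
  by (simp_all add: closed_ty_def)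

text \<open>Recovers from a tree the syntactic data demanded by the reduction rule
  \<open>pcase_app\<close>: the head of a closed type is closed, hence so are its two
  components.\<close>

lemma tree_of_NFunE:
  assumes "closed_ty r" "tree_of r = NFun A B"
  obtains a b where "closed_ty a" "closed_ty b" "tree_of a = A" "tree_of b = B" "r \<approx> TFun a b"
proof -
  obtain a b where ab: "ty_head r = TFun a b" "tree_of a = A" "tree_of b = B"
    using assms(2) by (subst (asm) tree_of.code) (auto split: ty.splits)
  then have "closed_ty a" "closed_ty b" using closed_ty_head[OF assms(1)] by simp_all
  with ab that assms(2) show ?thesis by (simp add: ty_equiv_def)
qed

section \<open>Inversion of typing up to equivalence of types\<close>

lemma has_ty_closed: "has_ty G M t \<Longrightarrow> closed_ty t"
  by (induction rule: has_ty.induct) auto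

text \<open>A conversion at the end of the derivation is absorbed into the type of the function; the
  new arrow type is closed because the type of the argument and the target of the conversion
  are.\<close>

lemma has_ty_App:
  assumes "has_ty G (M \<bullet> N) t"
  obtains s where "has_ty G M (TFun s t)" "has_ty G N s"
proof -
  have "\<exists>s. has_ty G M (TFun s t) \<and> has_ty G N s"
    using assms
  proof (induction G "M \<bullet> N" t rule: has_ty.induct)
    case (ty_conv G t u)
    then obtain s where "has_ty G M (TFun s t)" "has_ty G N s" by blast
    moreover have "has_ty G M (TFun s u)"
      using \<open>has_ty G M (TFun s t)\<close> by (rule has_ty.ty_conv)
        (use ty_conv has_ty_closed \<open>has_ty G N s\<close> in \<open>auto simp: ty_equiv_def\<close>)
    ultimately show ?case by blast
  qed auto
  with that show ?thesis by blast
qed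

lemma has_ty_Const: "has_ty G (Const c) t \<Longrightarrow> const_ty c \<approx> t \<and> closed_ty (const_ty c)"
  by (induction G "Const c" t rule: has_ty.induct) (auto simp: ty_equiv_def)

lemma has_ty_Lam:
  "has_ty G (Lam s M) t \<Longrightarrow> closed_ty s \<and> (\<exists>u. has_ty (s # G) M u \<and> TFun s u \<approx> t)"
  by (induction G "Lam s M" t rule: has_ty.induct) (auto simp: ty_equiv_def)

text \<open>When \<open>TFun a b\<close> is the type of \<open>M\<close> up to equivalence, the
  argument can be retyped at exactly \<open>a\<close>, and the remaining discrepancy moves into the
  result type. Iteration along the arguments of a constant gives the next three lemmas.\<close>

lemma has_ty_App_principal:
  assumes "has_ty G (M \<bullet> N) t" and "\<And>v. has_ty G M v \<Longrightarrow> TFun a b \<approx> v" and "closed_ty a"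
  shows "has_ty G N a \<and> b \<approx> t"
proof -
  obtain s where s: "has_ty G M (TFun s t)" "has_ty G N s" using assms(1) by (rule has_ty_App)
  then show ?thesis using assms(2)[OF s(1)] assms(3) has_ty.ty_conv[OF s(2), of a]
    by (simp add: ty_equiv_def)
qed

lemma has_ty_Const1:
  assumes "has_ty G (Const c \<bullet> x) t" "const_ty c = TFun a b"
  shows "closed_ty (const_ty c)" "has_ty G x a" "b \<approx> t"
proof -
  show c: "closed_ty (const_ty c)" using assms(1) has_ty_App has_ty_Const by metis
  show "has_ty G x a" "b \<approx> t"
    using has_ty_App_principal[OF assms(1), of a b] has_ty_Const[of G c] assms(2) c by auto
qed

lemma has_ty_Const2:
  assumes "has_ty G (Const c \<bullet> x \<bullet> y) t" "const_ty c = TFun a (TFun b d)"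
  shows "closed_ty (const_ty c)" "has_ty G x a" "has_ty G y b" "d \<approx> t"
proof -
  obtain s where s: "has_ty G (Const c \<bullet> x) (TFun s t)" using assms(1) by (rule has_ty_App)
  show c: "closed_ty (const_ty c)" "has_ty G x a"
    using has_ty_Const1[OF s assms(2)] by simp_all
  show "has_ty G y b" "d \<approx> t"
    using has_ty_App_principal[OF assms(1), of b d] has_ty_Const1(3)[OF _ assms(2)] assms(2) c(1)
    by auto
qed

lemma has_ty_Const3:
  assumes "has_ty G (Const c \<bullet> x \<bullet> y \<bullet> z) t" "const_ty c = TFun a (TFun b (TFun d e))"
  shows "closed_ty (const_ty c)" "has_ty G x a" "has_ty G y b" "has_ty G z d" "e \<approx> t"
proof -
  obtain s where s: "has_ty G (Const c \<bullet> x \<bullet> y) (TFun s t)" using assms(1) by (rule has_ty_App)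
  show c: "closed_ty (const_ty c)" "has_ty G x a" "has_ty G y b"
    using has_ty_Const2[OF s assms(2)] by simp_all
  show "has_ty G z d" "e \<approx> t"
    using has_ty_App_principal[OF assms(1), of d e] has_ty_Const2(4)[OF _ assms(2)] assms(2) c(1)
    by auto
qed

lemma has_ty_Const1I:
  "const_ty c = TFun a b \<Longrightarrow> closed_ty (const_ty c) \<Longrightarrow> has_ty G x a \<Longrightarrow> has_ty G (Const c \<bullet> x) b"
  by (metis has_ty.ty_Const has_ty.ty_App)

lemma has_ty_Const2I:
  "const_ty c = TFun a (TFun b d) \<Longrightarrow> closed_ty (const_ty c) \<Longrightarrow> has_ty G x a \<Longrightarrow> has_ty G y b \<Longrightarrow>
   has_ty G (Const c \<bullet> x \<bullet> y) d"
  by (metis has_ty_Const1I has_ty.ty_App)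

lemma has_ty_Const3I:
  "const_ty c = TFun a (TFun b (TFun d e)) \<Longrightarrow> closed_ty (const_ty c) \<Longrightarrow> has_ty G x a \<Longrightarrow>
   has_ty G y b \<Longrightarrow> has_ty G z d \<Longrightarrow> has_ty G (Const c \<bullet> x \<bullet> y \<bullet> z) e"
  by (metis has_ty_Const2I has_ty.ty_App)

section \<open>Typing of lifted and substituted terms\<close>

lemma has_ty_lift:
  "has_ty (G1 @ G2) M t \<Longrightarrow> has_ty (G1 @ u # G2) (lift (length G1) M) t"
proof (induction "G1 @ G2" M t arbitrary: G1 rule: has_ty.induct)
  case (ty_Var i)
  then show ?case
    using has_ty.ty_Var[of i "G1 @ u # G2"] has_ty.ty_Var[of "Suc i" "G1 @ u # G2"]
    by (auto simp: nth_append Suc_diff_le)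
next
  case (ty_Lam s M t)
  then show ?case using ty_Lam.hyps(3)[of "s # G1"] by (auto intro: has_ty.ty_Lam)
qed (auto intro: has_ty.intros)

lemma has_ty_subst:
  "has_ty (G1 @ u # G2) M t \<Longrightarrow> has_ty (G1 @ G2) N u \<Longrightarrow> has_ty (G1 @ G2) (subst N (length G1) M) t"
proof (induction "G1 @ u # G2" M t arbitrary: G1 N rule: has_ty.induct)
  case (ty_Var i)
  show ?case
  proof (cases "i < length G1 \<or> i = length G1")
    case True
    then show ?thesis using ty_Var has_ty.ty_Var[of i "G1 @ G2"] by (auto simp: nth_append)
  next
    case False
    then obtain j where "i = Suc j" "j \<ge> length G1" by (cases i) auto
    then show ?thesis using ty_Var has_ty.ty_Var[of j "G1 @ G2"]
      by (auto simp: nth_append Suc_diff_le)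
  qed
next
  case (ty_Lam s M t)
  have "has_ty (s # G1 @ G2) (lift 0 N) u"
    using has_ty_lift[of "[]" "G1 @ G2" N u s] ty_Lam.prems by simp
  then show ?case using ty_Lam.hyps(3)[of "s # G1" "lift 0 N"] ty_Lam.hyps(1)
    by (auto intro: has_ty.ty_Lam)
qed (auto intro: has_ty.intros)


section \<open>Soundness of reduction\<close>

lemma sem_Lam: "sem (Lam s M) e = tree_abs (tree_of s) (\<lambda>d. sem M (case_nat d e))"
  by (simp add: fn_abs_ty_ps)

lemma sem_mono: "(\<And>i. e i \<subseteq> e' i) \<Longrightarrow> sem M e \<subseteq> sem M e'"
proof (induction M arbitrary: e e')
  case (App M N)
  then show ?case by (simp add: fn_app_mono)
next
  case (Lam s M)
  show ?case unfolding sem_Lam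
    by (intro tree_abs_mono Lam.IH) (auto split: nat.splits simp: Lam.prems)
qed auto

text \<open>The finite sets need not be points, so that neither typing nor closure under \<open>ple\<close>
  interferes.\<close>

lemma sem_finite:
  "p \<in> sem M e \<Longrightarrow> \<exists>E. (\<forall>i. finite (E i) \<and> E i \<subseteq> e i) \<and> p \<in> sem M E"
proof (induction M arbitrary: e p)
  case (Var i)
  then show ?case by (intro exI[of _ "(\<lambda>_. {})(i := {p})"]) simp
next
  case (Const c)
  then show ?case by (intro exI[of _ "\<lambda>_. {}"]) simp
next
  case (App M N)
  then obtain Y where Y: "Fn Y p \<in> sem M e" "fset Y \<subseteq> sem N e" by (auto simp: fn_app_def)
  obtain E where E: "\<forall>i. finite (E i) \<and> E i \<subseteq> e i" "Fn Y p \<in> sem M E"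
    using App.IH(1)[OF Y(1)] by (elim exE conjE)
  have "\<forall>y\<in>fset Y. \<exists>E. (\<forall>i. finite (E i) \<and> E i \<subseteq> e i) \<and> y \<in> sem N E"
    using Y(2) by (intro ballI App.IH(2)) (rule subsetD)
  then obtain F where F: "\<forall>y\<in>fset Y. (\<forall>i. finite (F y i) \<and> F y i \<subseteq> e i) \<and> y \<in> sem N (F y)"
    by (elim exE[OF bchoice])
  \<comment> \<open>Finitely many finite environments, one for the step prime and one for each of
    its arguments, are merged.\<close>
  define H where "H i = E i \<union> (\<Union>y\<in>fset Y. F y i)" for i
  have "Fn Y p \<in> sem M H" using E(2) sem_mono[of E H M] by (auto simp: H_def)
  moreover have "y \<in> sem N H" if "y \<in> fset Y" for y
  proof -
    have "sem N (F y) \<subseteq> sem N H" by (rule sem_mono) (use that in \<open>auto simp: H_def\<close>)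
    then show ?thesis using F that by blast
  qed
  ultimately have "p \<in> sem (M \<bullet> N) H" by (auto simp: fn_app_def)
  moreover have "\<forall>i. finite (H i)" using E F by (auto simp: H_def)
  moreover have "H i \<subseteq> e i" for i unfolding H_def using E F by (intro Un_least UN_least) simp_all
  ultimately show ?case by (intro exI[of _ H]) simp
next
  case (Lam s M)
  then obtain X b where X: "p = Fn X b" "\<forall>x\<in>fset X. prime_of (tree_of s) x" "consistent (fset X)"
    "b \<in> sem M (case_nat (gen (tree_of s) (fset X)) e)" by (auto simp: tree_abs_def fn_abs_ty_ps)
  obtain E where E: "\<forall>i. finite (E i) \<and> E i \<subseteq> case_nat (gen (tree_of s) (fset X)) e i" "b \<in> sem M E"
    using Lam.IH[OF X(4)] by (elim exE conjE)
  \<comment> \<open>The part of \<open>E\<close> at the bound variable is enlarged to the whole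
    generated point, which leaves the shifted remainder as the finite environment of the
    abstraction.\<close>
  have "sem M E \<subseteq> sem M (case_nat (gen (tree_of s) (fset X)) (\<lambda>i. E (Suc i)))"
    by (rule sem_mono) (use E(1)[rule_format, of 0] in \<open>auto split: nat.splits\<close>)
  then have "p \<in> sem (Lam s M) (\<lambda>i. E (Suc i))" using E(2) X by (auto simp: tree_abs_def fn_abs_ty_ps)
  moreover have "\<forall>i. finite (E (Suc i)) \<and> E (Suc i) \<subseteq> e i"
  proof
    show "finite (E (Suc i)) \<and> E (Suc i) \<subseteq> e i" for i using E(1)[rule_format, of "Suc i"] by simp
  qed
  ultimately show ?case by (intro exI[of _ "\<lambda>i. E (Suc i)"]) simp
qed

text \<open>Only the component \<open>E 0\<close> at the bound variable is kept finite; elsewhere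
  monotonicity enlarges the environment back to \<open>e\<close>. This is the finitary half of the
  continuity of \<lambda>-bodies.\<close>

lemma sem_case_nat_finite:
  assumes "p \<in> sem M (case_nat d e)"
  shows "\<exists>X. finite X \<and> X \<subseteq> d \<and> (\<forall>d'. X \<subseteq> d' \<longrightarrow> d' \<subseteq> d \<longrightarrow> p \<in> sem M (case_nat d' e))"
proof -
  obtain E where E: "\<forall>i. finite (E i) \<and> E i \<subseteq> case_nat d e i" "p \<in> sem M E"
    using sem_finite[OF assms] by (elim exE conjE)
  have "sem M E \<subseteq> sem M (case_nat d' e)" if "E 0 \<subseteq> d'" for d'
  proof (rule sem_mono)
    show "E i \<subseteq> case_nat d' e i" for i
      using E(1)[rule_format, of i] that by (cases i) auto
  qed
  then show ?thesis using E(1)[rule_format, of 0] E(2) by (intro exI[of _ "E 0"]) auto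
qed

definition env_ok :: "ty list \<Rightarrow> (nat \<Rightarrow> prime set) \<Rightarrow> bool" where
  "env_ok G e \<longleftrightarrow> (\<forall>i<length G. e i \<in> points (tree_of (G ! i)))"

lemma env_ok_Cons: "env_ok G e \<Longrightarrow> d \<in> points (tree_of s) \<Longrightarrow> env_ok (s # G) (case_nat d e)"
  unfolding env_ok_def by (auto simp: nth_Cons split: nat.splits)

lemma const_sem_points: "const_sem c \<in> points (tree_of (const_ty c))"
  by (cases c)
    (simp_all add: fn_abs_ty_ps contin_points contin_inj0 contin_inj1 contin_case1 contin_pcase1
      contin_pair contin_fst_val contin_snd_val)

lemma contin_sem:
  assumes "\<And>d. d \<in> points A \<Longrightarrow> sem M (case_nat d e) \<in> points B"
  shows "contin A B (\<lambda>d. sem M (case_nat d e))"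
proof (rule continI)
  show "sem M (case_nat d e) \<subseteq> sem M (case_nat d' e)" if "d \<subseteq> d'" for d d'
    by (rule sem_mono) (use that in \<open>auto split: nat.splits\<close>)
qed (use assms sem_case_nat_finite in auto)

text \<open>Conversion costs nothing because equivalent types have the same points; the abstraction
  case rests on continuity of the body.\<close>

lemma sem_points: "has_ty G M t \<Longrightarrow> env_ok G e \<Longrightarrow> sem M e \<in> points (tree_of t)"
proof (induction arbitrary: e rule: has_ty.induct)
  case (ty_Var i G)
  then show ?case by (simp add: env_ok_def)
next
  case (ty_Const c G)
  then show ?case by (simp add: const_sem_points)
next
  case (ty_App G M s t N)
  then show ?case by (auto intro: fn_app_points)
next
  case (ty_Lam s G M t)
  then show ?case unfolding sem_Lam tree_of_simps
    by (intro contin_points contin_sem) (auto intro: env_ok_Cons)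
next
  case (ty_conv G M s t)
  then show ?case by (simp add: ty_equiv_def)
qed

lemma sem_lift: "sem (lift k M) e = sem M (\<lambda>i. e (if i < k then i else Suc i))"
proof (induction M arbitrary: k e)
  case (Lam s M)
  have "(\<lambda>i. case_nat d e (if i < Suc k then i else Suc i)) =
    case_nat d (\<lambda>i. e (if i < k then i else Suc i))" for d
    by (rule ext) (auto split: nat.splits)
  then show ?case by (simp add: Lam.IH)
qed auto

lemma sem_subst:
  "sem (subst N k M) e = sem M (\<lambda>i. if i < k then e i else if i = k then sem N e else e (i - 1))"
proof (induction M arbitrary: N k e)
  case (Lam s M)
  have "(\<lambda>i. if i < Suc k then case_nat d e i
      else if i = Suc k then sem (lift 0 N) (case_nat d e) else case_nat d e (i - 1)) =
    case_nat d (\<lambda>i. if i < k then e i else if i = k then sem N e else e (i - 1))" for d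
    by (rule ext) (auto split: nat.splits simp: sem_lift)
  then show ?case by (simp add: Lam.IH)
qed auto

lemma sem_subst_0: "sem (subst N 0 M) e = sem M (case_nat (sem N e) e)"
proof -
  have "(\<lambda>i. if i < 0 then e i else if i = 0 then sem N e else e (i - 1)) = case_nat (sem N e) e"
    by (rule ext) (auto split: nat.splits)
  then show ?thesis by (simp add: sem_subst)
qed

section \<open>Denotations of fully applied constants\<close>

lemma sem_In0: "x \<in> points (tree_of s) \<Longrightarrow> fn_app (const_sem (In0 s t)) x = inj0 x"
  by (simp add: fn_abs_ty_ps contin_app[OF contin_inj0[where B = "tree_of t"]])

lemma sem_In1: "x \<in> points (tree_of t) \<Longrightarrow> fn_app (const_sem (In1 s t)) x = inj1 x"
  by (simp add: fn_abs_ty_ps contin_app[OF contin_inj1[where A = "tree_of s"]])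

lemma sem_Fst: "x \<in> points (tree_of (TProd s t)) \<Longrightarrow> fn_app (const_sem (Fst s t)) x = fst_val x"
  by (simp add: fn_abs_ty_ps contin_app[OF contin_fst_val])

lemma sem_Snd: "x \<in> points (tree_of (TProd s t)) \<Longrightarrow> fn_app (const_sem (Snd s t)) x = snd_val x"
  by (simp add: fn_abs_ty_ps contin_app[OF contin_snd_val])

lemma sem_Pair:
  "x \<in> points (tree_of s) \<Longrightarrow> y \<in> points (tree_of t) \<Longrightarrow>
   fn_app (fn_app (const_sem (Pair s t)) x) y = pair_val x y"
  by (simp add: fn_abs_ty_ps contin_app[OF contin_pair] contin_app[OF contin_pair_val2])

lemma sem_Case:
  "x \<in> points (tree_of (TSum s t)) \<Longrightarrow> y \<in> points (tree_of (TFun s r)) \<Longrightarrow>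
   z \<in> points (tree_of (TFun t r)) \<Longrightarrow>
   fn_app (fn_app (fn_app (const_sem (Case s t r)) x) y) z = case_val x y z"
  by (simp add: fn_abs_ty_ps contin_app[OF contin_case1] contin_app[OF contin_case2]
      contin_app[OF contin_case_val3])

lemma sem_Pcase:
  "x \<in> points (tree_of (TSum s t)) \<Longrightarrow> y \<in> points (tree_of r) \<Longrightarrow> z \<in> points (tree_of r) \<Longrightarrow>
   fn_app (fn_app (fn_app (const_sem (Pcase s t r)) x) y) z = pcase_val x y z"
  by (simp add: fn_abs_ty_ps contin_app[OF contin_pcase1] contin_app[OF contin_pcase2]
      contin_app[OF contin_pcase_val3])

lemma case_val_inj: "case_val (inj0 d) f g = fn_app f d" "case_val (inj1 d) f g = fn_app g d"
  by (simp_all add: case_val_def inj0_def inj1_def inj_image_mem_iff inj_def image_iff)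

lemma pcase_val_inj: "pcase_val (inj0 d) b c = b" "pcase_val (inj1 d) b c = c"
  by (auto simp: pcase_val_def inj0_def inj1_def)

text \<open>With an undecided scrutinee this says that an injection commutes with intersection; it
  is the semantic content of the rules \<open>pcase_00\<close> and \<open>pcase_11\<close>.\<close>

lemma pcase_val_inj_arg:
  "pcase_val x (inj0 b) (inj0 c) = inj0 (pcase_val x b c)"
  "pcase_val x (inj1 b) (inj1 c) = inj1 (pcase_val x b c)"
  by (auto simp: pcase_val_def inj0_def inj1_def)

lemma pcase_val_pair:
  "pcase_val x (pair_val a b) (pair_val c d) = pair_val (pcase_val x a c) (pcase_val x b d)"
  by (auto simp: pcase_val_def pair_val_def)

lemma fst_snd_pair: "fst_val (pair_val a b) = a" "snd_val (pair_val a b) = b"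
  by (auto simp: fst_val_def snd_val_def pair_val_def)

text \<open>Meets of functions are computed pointwise, which justifies \<open>pcase_app\<close>. If
  \<open>b\<close> is produced by steps with arguments \<open>X\<close> and \<open>Y\<close>, both
  within \<open>d\<close>, then \<open>X \<union> Y\<close> is consistent, and the step prime with
  this argument set lies below both, hence in both functions.\<close>

lemma fn_app_Int:
  assumes f: "f \<in> points (NFun A B)" and g: "g \<in> points (NFun A B)" and d: "d \<in> points A"
  shows "fn_app (f \<inter> g) d = fn_app f d \<inter> fn_app g d"
proof
  show "fn_app f d \<inter> fn_app g d \<subseteq> fn_app (f \<inter> g) d"
  proof
    fix b assume "b \<in> fn_app f d \<inter> fn_app g d"
    then obtain X Y where XY: "Fn X b \<in> f" "fset X \<subseteq> d" "Fn Y b \<in> g" "fset Y \<subseteq> d"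
      by (auto simp: fn_app_def)
    have "fset (X |\<union>| Y) \<subseteq> d" using XY by auto
    then have p: "prime_of (NFun A B) (Fn (X |\<union>| Y) b)"
      using points_prime_of[OF f XY(1)] points_prime_of[OF d]
        consistent_subset[OF points_consistent[OF d]] by auto
    have "ple (Fn (X |\<union>| Y) b) (Fn X b)" "ple (Fn (X |\<union>| Y) b) (Fn Y b)"
      by (auto intro: bexI[of _ _ "fset X \<union> fset Y", OF ple_refl])
    then have "Fn (X |\<union>| Y) b \<in> f \<inter> g"
      using points_down[OF f XY(1) p] points_down[OF g XY(3) p] by blast
    then show "b \<in> fn_app (f \<inter> g) d"
      using \<open>fset (X |\<union>| Y) \<subseteq> d\<close> unfolding fn_app_def by blast
  qed
qed (auto simp: fn_app_def)

lemma fn_app_pcase_val: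
  "f \<in> points (NFun A B) \<Longrightarrow> g \<in> points (NFun A B) \<Longrightarrow> d \<in> points A \<Longrightarrow>
   fn_app (pcase_val x f g) d = pcase_val x (fn_app f d) (fn_app g d)"
  by (simp add: pcase_val_def fn_app_Int)

section \<open>Preservation of types and denotations, rule by rule\<close>

lemma has_ty_tree_of:
  "has_ty G M s \<Longrightarrow> tree_of s = tree_of t \<Longrightarrow> closed_ty t \<Longrightarrow> has_ty G M t"
  by (erule has_ty.ty_conv) (simp_all add: ty_equiv_def)

text \<open>Typing and denotation travel together: equality of denotations is obtained from a typed
  redex, and the next reduction step then needs a typed reduct.\<close>

definition red_ok :: "ty list \<Rightarrow> tm \<Rightarrow> tm \<Rightarrow> ty \<Rightarrow> bool" where
  "red_ok G M M' t \<longleftrightarrow> has_ty G M' t \<and> (\<forall>e. env_ok G e \<longrightarrow> sem M' e = sem M e)"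

lemma red_okI:
  assumes "has_ty G M t" "has_ty G M' s" "s \<approx> t" "\<And>e. env_ok G e \<Longrightarrow> sem M' e = sem M e"
  shows "red_ok G M M' t"
  using assms has_ty.ty_conv[of G M' s t] has_ty_closed[OF assms(1)] unfolding red_ok_def by simp

lemma red_ok_beta:
  assumes ty: "has_ty G (Lam s M \<bullet> N) t"
  shows "red_ok G (Lam s M \<bullet> N) (subst N 0 M) t"
proof -
  obtain s' where s': "has_ty G (Lam s M) (TFun s' t)" "has_ty G N s'" using ty by (rule has_ty_App)
  then obtain u where u: "closed_ty s" "has_ty (s # G) M u" "TFun s u \<approx> TFun s' t"
    using has_ty_Lam by blast
  \<comment> \<open>The argument is retyped at the annotation \<open>s\<close>, whose tree is the
    domain of the denoted abstraction.\<close>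
  have N: "has_ty G N s" using s'(2) u by (auto intro: has_ty_tree_of simp: ty_equiv_def)
  show ?thesis using ty
  proof (rule red_okI)
    show "has_ty G (subst N 0 M) u" using has_ty_subst[of "[]" s G M u N] u N by simp
    show "u \<approx> t" using u(3) by (simp add: ty_equiv_def)
    fix e assume e: "env_ok G e"
    have "contin (tree_of s) (tree_of u) (\<lambda>d. sem M (case_nat d e))"
      by (rule contin_sem) (rule sem_points[OF u(2) env_ok_Cons[OF e]])
    then show "sem (subst N 0 M) e = sem (Lam s M \<bullet> N) e"
      using sem_points[OF N e] by (simp add: sem_subst_0 fn_abs_ty_ps contin_app)
  qed
qed

text \<open>The annotations of the injection and of \<open>case\<close> agree only up to
  equivalence; comparing them at the type of the scrutinee lets \<open>x\<close> be retyped at the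
  domain of the branch, which makes \<open>y \<bullet> x\<close> typable.\<close>

lemma red_ok_case_0:
  assumes ty: "has_ty G (Const (Case s t r) \<bullet> (Const (In0 s' t') \<bullet> x) \<bullet> y \<bullet> z) u"
  shows "red_ok G (Const (Case s t r) \<bullet> (Const (In0 s' t') \<bullet> x) \<bullet> y \<bullet> z) (y \<bullet> x) u"
proof -
  note c = has_ty_Const3[OF ty const_ty.simps(3)]
  note i = has_ty_Const1[OF c(2) const_ty.simps(1)]
  have x: "has_ty G x s" using i c(1) by (auto intro: has_ty_tree_of simp: ty_equiv_def)
  show ?thesis using ty
  proof (rule red_okI)
    show "has_ty G (y \<bullet> x) r" using c(3) x by (rule has_ty.ty_App)
    fix e assume e: "env_ok G e"
    have "sem (Const (In0 s' t') \<bullet> x) e = inj0 (sem x e)"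
      using sem_In0[OF sem_points[OF i(2) e]] by simp
    moreover have "sem (Const (Case s t r) \<bullet> (Const (In0 s' t') \<bullet> x) \<bullet> y \<bullet> z) e =
      case_val (sem (Const (In0 s' t') \<bullet> x) e) (sem y e) (sem z e)"
      using sem_Case sem_points[OF c(2) e] sem_points[OF c(3) e] sem_points[OF c(4) e]
      by (simp only: sem.simps)
    ultimately show "sem (y \<bullet> x) e = sem (Const (Case s t r) \<bullet> (Const (In0 s' t') \<bullet> x) \<bullet> y \<bullet> z) e"
      by (simp add: case_val_inj)
  qed (rule c(5))
qed

lemma red_ok_case_1:
  assumes ty: "has_ty G (Const (Case s t r) \<bullet> (Const (In1 s' t') \<bullet> x) \<bullet> y \<bullet> z) u"
  shows "red_ok G (Const (Case s t r) \<bullet> (Const (In1 s' t') \<bullet> x) \<bullet> y \<bullet> z) (z \<bullet> x) u"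
proof -
  note c = has_ty_Const3[OF ty const_ty.simps(3)]
  note i = has_ty_Const1[OF c(2) const_ty.simps(2)]
  have x: "has_ty G x t" using i c(1) by (auto intro: has_ty_tree_of simp: ty_equiv_def)
  show ?thesis using ty
  proof (rule red_okI)
    show "has_ty G (z \<bullet> x) r" using c(4) x by (rule has_ty.ty_App)
    fix e assume e: "env_ok G e"
    have "sem (Const (In1 s' t') \<bullet> x) e = inj1 (sem x e)"
      using sem_In1[OF sem_points[OF i(2) e]] by simp
    moreover have "sem (Const (Case s t r) \<bullet> (Const (In1 s' t') \<bullet> x) \<bullet> y \<bullet> z) e =
      case_val (sem (Const (In1 s' t') \<bullet> x) e) (sem y e) (sem z e)"
      using sem_Case sem_points[OF c(2) e] sem_points[OF c(3) e] sem_points[OF c(4) e]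
      by (simp only: sem.simps)
    ultimately show "sem (z \<bullet> x) e = sem (Const (Case s t r) \<bullet> (Const (In1 s' t') \<bullet> x) \<bullet> y \<bullet> z) e"
      by (simp add: case_val_inj)
  qed (rule c(5))
qed

lemma red_ok_fst:
  assumes ty: "has_ty G (Const (Fst s t) \<bullet> (Const (Pair s' t') \<bullet> x \<bullet> y)) u"
  shows "red_ok G (Const (Fst s t) \<bullet> (Const (Pair s' t') \<bullet> x \<bullet> y)) x u"
proof -
  note c = has_ty_Const1[OF ty const_ty.simps(6)]
  note i = has_ty_Const2[OF c(2) const_ty.simps(5)]
  show ?thesis using ty i(2)
  proof (rule red_okI)
    show "s' \<approx> u" using i(4) c(3) by (simp add: ty_equiv_def)
    fix e assume e: "env_ok G e"
    have "sem (Const (Pair s' t') \<bullet> x \<bullet> y) e = pair_val (sem x e) (sem y e)"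
      using sem_Pair[OF sem_points[OF i(2) e] sem_points[OF i(3) e]] by simp
    moreover have "sem (Const (Fst s t) \<bullet> (Const (Pair s' t') \<bullet> x \<bullet> y)) e =
      fst_val (sem (Const (Pair s' t') \<bullet> x \<bullet> y) e)"
      using sem_Fst[OF sem_points[OF c(2) e]] by (simp only: sem.simps)
    ultimately show "sem x e = sem (Const (Fst s t) \<bullet> (Const (Pair s' t') \<bullet> x \<bullet> y)) e"
      by (simp add: fst_snd_pair)
  qed
qed

lemma red_ok_snd:
  assumes ty: "has_ty G (Const (Snd s t) \<bullet> (Const (Pair s' t') \<bullet> x \<bullet> y)) u"
  shows "red_ok G (Const (Snd s t) \<bullet> (Const (Pair s' t') \<bullet> x \<bullet> y)) y u"
proof -
  note c = has_ty_Const1[OF ty const_ty.simps(7)]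
  note i = has_ty_Const2[OF c(2) const_ty.simps(5)]
  show ?thesis using ty i(3)
  proof (rule red_okI)
    show "t' \<approx> u" using i(4) c(3) by (simp add: ty_equiv_def)
    fix e assume e: "env_ok G e"
    have "sem (Const (Pair s' t') \<bullet> x \<bullet> y) e = pair_val (sem x e) (sem y e)"
      using sem_Pair[OF sem_points[OF i(2) e] sem_points[OF i(3) e]] by simp
    moreover have "sem (Const (Snd s t) \<bullet> (Const (Pair s' t') \<bullet> x \<bullet> y)) e =
      snd_val (sem (Const (Pair s' t') \<bullet> x \<bullet> y) e)"
      using sem_Snd[OF sem_points[OF c(2) e]] by (simp only: sem.simps)
    ultimately show "sem y e = sem (Const (Snd s t) \<bullet> (Const (Pair s' t') \<bullet> x \<bullet> y)) e"
      by (simp add: fst_snd_pair)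
  qed
qed

lemma sem_Pcase_tm:
  assumes "has_ty G x (TSum s t)" "has_ty G y r" "has_ty G z r" "env_ok G e"
  shows "sem (Const (Pcase s t r) \<bullet> x \<bullet> y \<bullet> z) e = pcase_val (sem x e) (sem y e) (sem z e)"
  using sem_Pcase sem_points[OF assms(1,4)] sem_points[OF assms(2,4)] sem_points[OF assms(3,4)]
  by (simp only: sem.simps)

lemma red_ok_pcase_0:
  assumes ty: "has_ty G (Const (Pcase s t r) \<bullet> (Const (In0 s' t') \<bullet> x) \<bullet> y \<bullet> z) u"
  shows "red_ok G (Const (Pcase s t r) \<bullet> (Const (In0 s' t') \<bullet> x) \<bullet> y \<bullet> z) y u"
proof -
  note c = has_ty_Const3[OF ty const_ty.simps(4)]
  note i = has_ty_Const1[OF c(2) const_ty.simps(1)]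
  show ?thesis using ty c(3) c(5)
  proof (rule red_okI)
    fix e assume e: "env_ok G e"
    show "sem y e = sem (Const (Pcase s t r) \<bullet> (Const (In0 s' t') \<bullet> x) \<bullet> y \<bullet> z) e"
      unfolding sem_Pcase_tm[OF c(2-4) e]
      using sem_In0[OF sem_points[OF i(2) e]] by (simp add: pcase_val_inj)
  qed
qed

lemma red_ok_pcase_1:
  assumes ty: "has_ty G (Const (Pcase s t r) \<bullet> (Const (In1 s' t') \<bullet> x) \<bullet> y \<bullet> z) u"
  shows "red_ok G (Const (Pcase s t r) \<bullet> (Const (In1 s' t') \<bullet> x) \<bullet> y \<bullet> z) z u"
proof -
  note c = has_ty_Const3[OF ty const_ty.simps(4)]
  note i = has_ty_Const1[OF c(2) const_ty.simps(2)]
  show ?thesis using ty c(4) c(5)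
  proof (rule red_okI)
    fix e assume e: "env_ok G e"
    show "sem z e = sem (Const (Pcase s t r) \<bullet> (Const (In1 s' t') \<bullet> x) \<bullet> y \<bullet> z) e"
      unfolding sem_Pcase_tm[OF c(2-4) e]
      using sem_In1[OF sem_points[OF i(2) e]] by (simp add: pcase_val_inj)
  qed
qed

lemma red_ok_pcase_00:
  assumes ty: "has_ty G (Const (Pcase s t r) \<bullet> x \<bullet> (Const (In0 a b) \<bullet> y) \<bullet> (Const (In0 a' b') \<bullet> z)) u"
  shows "red_ok G (Const (Pcase s t r) \<bullet> x \<bullet> (Const (In0 a b) \<bullet> y) \<bullet> (Const (In0 a' b') \<bullet> z))
    (Const (In0 a b) \<bullet> (Const (Pcase s t a) \<bullet> x \<bullet> y \<bullet> z)) u"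
proof -
  note c = has_ty_Const3[OF ty const_ty.simps(4)]
  note i = has_ty_Const1[OF c(3) const_ty.simps(1)]
  note j = has_ty_Const1[OF c(4) const_ty.simps(1)]
  \<comment> \<open>Both branches are typed at \<open>r\<close>; this is how the annotations of the
    two injections come to agree.\<close>
  have "TSum a' b' \<approx> TSum a b" using i(3) j(3) by (simp only: ty_equiv_def)
  then have z: "has_ty G z a" using has_ty_tree_of[OF j(2)] i(1) by (simp add: ty_equiv_def)
  have p: "has_ty G (Const (Pcase s t a) \<bullet> x \<bullet> y \<bullet> z) a"
    using has_ty_Const3I[OF const_ty.simps(4) _ c(2) i(2) z] c(1) i(1) by simp
  show ?thesis using ty has_ty_Const1I[OF const_ty.simps(1) i(1) p]
  proof (rule red_okI)
    show "TSum a b \<approx> u" using i(3) c(5) by (simp add: ty_equiv_def)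
    fix e assume e: "env_ok G e"
    show "sem (Const (In0 a b) \<bullet> (Const (Pcase s t a) \<bullet> x \<bullet> y \<bullet> z)) e =
      sem (Const (Pcase s t r) \<bullet> x \<bullet> (Const (In0 a b) \<bullet> y) \<bullet> (Const (In0 a' b') \<bullet> z)) e"
      unfolding sem_Pcase_tm[OF c(2-4) e]
      using sem_In0[OF sem_points[OF i(2) e]] sem_In0[OF sem_points[OF j(2) e]]
        sem_In0[OF sem_points[OF p e]] sem_Pcase_tm[OF c(2) i(2) z e]
      by (simp add: pcase_val_inj_arg del: const_sem.simps)
  qed
qed

lemma red_ok_pcase_11:
  assumes ty: "has_ty G (Const (Pcase s t r) \<bullet> x \<bullet> (Const (In1 a b) \<bullet> y) \<bullet> (Const (In1 a' b') \<bullet> z)) u"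
  shows "red_ok G (Const (Pcase s t r) \<bullet> x \<bullet> (Const (In1 a b) \<bullet> y) \<bullet> (Const (In1 a' b') \<bullet> z))
    (Const (In1 a b) \<bullet> (Const (Pcase s t b) \<bullet> x \<bullet> y \<bullet> z)) u"
proof -
  note c = has_ty_Const3[OF ty const_ty.simps(4)]
  note i = has_ty_Const1[OF c(3) const_ty.simps(2)]
  note j = has_ty_Const1[OF c(4) const_ty.simps(2)]
  have "TSum a' b' \<approx> TSum a b" using i(3) j(3) by (simp only: ty_equiv_def)
  then have z: "has_ty G z b" using has_ty_tree_of[OF j(2)] i(1) by (simp add: ty_equiv_def)
  have p: "has_ty G (Const (Pcase s t b) \<bullet> x \<bullet> y \<bullet> z) b"
    using has_ty_Const3I[OF const_ty.simps(4) _ c(2) i(2) z] c(1) i(1) by simp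
  show ?thesis using ty has_ty_Const1I[OF const_ty.simps(2) i(1) p]
  proof (rule red_okI)
    show "TSum a b \<approx> u" using i(3) c(5) by (simp add: ty_equiv_def)
    fix e assume e: "env_ok G e"
    show "sem (Const (In1 a b) \<bullet> (Const (Pcase s t b) \<bullet> x \<bullet> y \<bullet> z)) e =
      sem (Const (Pcase s t r) \<bullet> x \<bullet> (Const (In1 a b) \<bullet> y) \<bullet> (Const (In1 a' b') \<bullet> z)) e"
      unfolding sem_Pcase_tm[OF c(2-4) e]
      using sem_In1[OF sem_points[OF i(2) e]] sem_In1[OF sem_points[OF j(2) e]]
        sem_In1[OF sem_points[OF p e]] sem_Pcase_tm[OF c(2) i(2) z e]
      by (simp add: pcase_val_inj_arg del: const_sem.simps)
  qed
qed

lemma red_ok_pcase_pair: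
  assumes ty: "has_ty G (Const (Pcase s t r) \<bullet> x \<bullet> (Const (Pair a b) \<bullet> y1 \<bullet> y2)
    \<bullet> (Const (Pair a' b') \<bullet> z1 \<bullet> z2)) u"
  shows "red_ok G (Const (Pcase s t r) \<bullet> x \<bullet> (Const (Pair a b) \<bullet> y1 \<bullet> y2)
      \<bullet> (Const (Pair a' b') \<bullet> z1 \<bullet> z2))
    (Const (Pair a b) \<bullet> (Const (Pcase s t a) \<bullet> x \<bullet> y1 \<bullet> z1) \<bullet> (Const (Pcase s t b) \<bullet> x \<bullet> y2 \<bullet> z2)) u"
proof -
  note c = has_ty_Const3[OF ty const_ty.simps(4)]
  note i = has_ty_Const2[OF c(3) const_ty.simps(5)]
  note j = has_ty_Const2[OF c(4) const_ty.simps(5)]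
  have "TProd a' b' \<approx> TProd a b" using i(4) j(4) by (simp only: ty_equiv_def)
  then have z1: "has_ty G z1 a" and z2: "has_ty G z2 b"
    using has_ty_tree_of[OF j(2)] has_ty_tree_of[OF j(3)] i(1) by (simp_all add: ty_equiv_def)
  have p1: "has_ty G (Const (Pcase s t a) \<bullet> x \<bullet> y1 \<bullet> z1) a"
    using has_ty_Const3I[OF const_ty.simps(4) _ c(2) i(2) z1] c(1) i(1) by simp
  have p2: "has_ty G (Const (Pcase s t b) \<bullet> x \<bullet> y2 \<bullet> z2) b"
    using has_ty_Const3I[OF const_ty.simps(4) _ c(2) i(3) z2] c(1) i(1) by simp
  show ?thesis using ty has_ty_Const2I[OF const_ty.simps(5) i(1) p1 p2]
  proof (rule red_okI)
    show "TProd a b \<approx> u" using i(4) c(5) by (simp add: ty_equiv_def)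
    fix e assume e: "env_ok G e"
    show "sem (Const (Pair a b) \<bullet> (Const (Pcase s t a) \<bullet> x \<bullet> y1 \<bullet> z1)
        \<bullet> (Const (Pcase s t b) \<bullet> x \<bullet> y2 \<bullet> z2)) e =
      sem (Const (Pcase s t r) \<bullet> x \<bullet> (Const (Pair a b) \<bullet> y1 \<bullet> y2)
        \<bullet> (Const (Pair a' b') \<bullet> z1 \<bullet> z2)) e"
      unfolding sem_Pcase_tm[OF c(2-4) e]
      using sem_Pair[OF sem_points[OF i(2) e] sem_points[OF i(3) e]]
        sem_Pair[OF sem_points[OF j(2) e] sem_points[OF j(3) e]]
        sem_Pair[OF sem_points[OF p1 e] sem_points[OF p2 e]]
        sem_Pcase_tm[OF c(2) i(2) z1 e] sem_Pcase_tm[OF c(2) i(3) z2 e]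
      by (simp add: pcase_val_pair del: const_sem.simps)
  qed
qed

text \<open>The side conditions fix an arrow type \<open>TFun a b\<close> at which both branches can
  be retyped; the equation of denotations is then the pointwise computation of meets.\<close>

lemma red_ok_pcase_app:
  assumes ty: "has_ty G (Const (Pcase s t r) \<bullet> x \<bullet> y \<bullet> z \<bullet> w) u"
    and r: "r \<approx> TFun a b" "closed_ty a" "closed_ty b"
  shows "red_ok G (Const (Pcase s t r) \<bullet> x \<bullet> y \<bullet> z \<bullet> w) (Const (Pcase s t b) \<bullet> x \<bullet> (y \<bullet> w) \<bullet> (z \<bullet> w)) u"
proof -
  obtain v where v: "has_ty G (Const (Pcase s t r) \<bullet> x \<bullet> y \<bullet> z) (TFun v u)" "has_ty G w v"
    using ty by (rule has_ty_App)
  note c = has_ty_Const3[OF v(1) const_ty.simps(4)]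
  have y: "has_ty G y (TFun a b)" and z: "has_ty G z (TFun a b)"
    using c r by (auto intro: has_ty_tree_of simp: ty_equiv_def)
  have w: "has_ty G w a"
    using v(2) c(5) r by (auto intro: has_ty_tree_of simp: ty_equiv_def)
  note yw = has_ty.ty_App[OF y w] and zw = has_ty.ty_App[OF z w]
  have p: "has_ty G (Const (Pcase s t b) \<bullet> x \<bullet> (y \<bullet> w) \<bullet> (z \<bullet> w)) b"
    using has_ty_Const3I[OF const_ty.simps(4) _ c(2) yw zw] c(1) r(3) by simp
  show ?thesis using ty p
  proof (rule red_okI)
    show "b \<approx> u" using c(5) r(1) by (simp add: ty_equiv_def)
    fix e assume e: "env_ok G e"
    show "sem (Const (Pcase s t b) \<bullet> x \<bullet> (y \<bullet> w) \<bullet> (z \<bullet> w)) e = sem (Const (Pcase s t r) \<bullet> x \<bullet> y \<bullet> z \<bullet> w) e"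
      unfolding sem_Pcase_tm[OF c(2) yw zw e] sem.simps(3)[of _ w]
        sem_Pcase_tm[OF c(2-4) e]
      using sem_points[OF y e] sem_points[OF z e] sem_points[OF w e]
      by (simp add: fn_app_pcase_val)
  qed
qed

lemma red_sound: "red M M' \<Longrightarrow> has_ty G M t \<Longrightarrow> red_ok G M M' t"
proof (induction arbitrary: G t rule: red.induct)
  case (ctx_App1 M M' N)
  from ctx_App1.prems obtain s where "has_ty G M (TFun s t)" "has_ty G N s" by (rule has_ty_App)
  with ctx_App1.IH show ?case by (auto simp: red_ok_def intro: has_ty.ty_App)
next
  case (ctx_App2 N N' M)
  from ctx_App2.prems obtain s where "has_ty G M (TFun s t)" "has_ty G N s" by (rule has_ty_App)
  with ctx_App2.IH show ?case by (auto simp: red_ok_def intro: has_ty.ty_App)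
next
  case (ctx_Lam M M' s)
  then obtain u where u: "closed_ty s" "has_ty (s # G) M u" "TFun s u \<approx> t"
    using has_ty_Lam by blast
  note IH = ctx_Lam.IH[OF u(2), unfolded red_ok_def]
  show ?case using ctx_Lam.prems
  proof (rule red_okI)
    show "has_ty G (Lam s M') (TFun s u)" using u(1) IH by (auto intro: has_ty.ty_Lam)
    fix e assume e: "env_ok G e"
    \<comment> \<open>An abstraction evaluates its body at points only, so the extended environments
      are again well-typed.\<close>
    have "tree_abs (tree_of s) (\<lambda>d. sem M' (case_nat d e)) = tree_abs (tree_of s) (\<lambda>d. sem M (case_nat d e))"
      by (intro subset_antisym tree_abs_mono) (use IH env_ok_Cons[OF e] in auto)
    then show "sem (Lam s M') e = sem (Lam s M) e" by (simp only: sem_Lam)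
  qed (rule u(3))
qed (rule red_ok_beta red_ok_case_0 red_ok_case_1 red_ok_fst red_ok_snd red_ok_pcase_0 red_ok_pcase_1
    red_ok_pcase_00 red_ok_pcase_11 red_ok_pcase_pair red_ok_pcase_app; assumption)+

lemma red_star_sound: "red\<^sup>*\<^sup>* M M' \<Longrightarrow> has_ty G M t \<Longrightarrow> red_ok G M M' t"
proof (induction rule: rtranclp_induct)
  case base
  then show ?case by (simp add: red_ok_def)
next
  case (step M' M'')
  then have 1: "red_ok G M M' t" by blast
  then have "red_ok G M' M'' t"
    using red_sound[OF step.hyps(2), of G t] unfolding red_ok_def[of G M M' t] by blast
  with 1 show ?case by (auto simp: red_ok_def)
qed

text \<open>The component has the tree of \<open>void\<close>, which has no primes, so the injection
  denotes the bare tag.\<close>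

lemma den_In0:
  assumes "program M" "red\<^sup>*\<^sup>* M (Const (In0 s t) \<bullet> M')"
  shows "den M = {Tag0}"
proof -
  have e: "env_ok [] (\<lambda>_. {})" by (simp add: env_ok_def)
  have ok: "red_ok [] M (Const (In0 s t) \<bullet> M') ty_bool"
    using assms red_star_sound unfolding program_def by blast
  note i = has_ty_Const1[OF ok[unfolded red_ok_def, THEN conjunct1] const_ty.simps(1)]
  have void: "tree_of s = NVoid" using i(3) by (simp add: ty_equiv_def ty_bool_def)
  have "sem M' (\<lambda>_. {}) = {}"
    using points_prime_of[OF sem_points[OF i(2) e]] unfolding void by auto
  then show ?thesis
    using ok[unfolded red_ok_def, THEN conjunct2, rule_format, OF e] sem_In0[OF sem_points[OF i(2) e]]
    by (simp add: den_def inj0_def)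
qed

lemma den_In1:
  assumes "program M" "red\<^sup>*\<^sup>* M (Const (In1 s t) \<bullet> M')"
  shows "den M = {Tag1}"
proof -
  have e: "env_ok [] (\<lambda>_. {})" by (simp add: env_ok_def)
  have ok: "red_ok [] M (Const (In1 s t) \<bullet> M') ty_bool"
    using assms red_star_sound unfolding program_def by blast
  note i = has_ty_Const1[OF ok[unfolded red_ok_def, THEN conjunct1] const_ty.simps(2)]
  have void: "tree_of t = NVoid" using i(3) by (simp add: ty_equiv_def ty_bool_def)
  have "sem M' (\<lambda>_. {}) = {}"
    using points_prime_of[OF sem_points[OF i(2) e]] unfolding void by auto
  then show ?thesis
    using ok[unfolded red_ok_def, THEN conjunct2, rule_format, OF e] sem_In1[OF sem_points[OF i(2) e]]
    by (simp add: den_def inj1_def)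
qed


section \<open>Parallel substitution\<close>

abbreviation up :: "(nat \<Rightarrow> tm) \<Rightarrow> nat \<Rightarrow> tm" where
  "up g \<equiv> case_nat (Var 0) (\<lambda>i. lift 0 (g i))"

fun psubst :: "(nat \<Rightarrow> tm) \<Rightarrow> tm \<Rightarrow> tm" where
  "psubst g (Var i) = g i"
| "psubst g (Const c) = Const c"
| "psubst g (M \<bullet> N) = psubst g M \<bullet> psubst g N"
| "psubst g (Lam s M) = Lam s (psubst (up g) M)"

lemma lift_lift: "j \<le> k \<Longrightarrow> lift (Suc k) (lift j M) = lift j (lift k M)"
  by (induction M arbitrary: j k) auto

lemma subst_lift: "subst N k (lift k M) = M"
  by (induction M arbitrary: N k) auto

lemma subst_lift_le: "j \<le> k \<Longrightarrow> subst (lift j N) (Suc k) (lift j M) = lift j (subst N k M)"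
proof (induction M arbitrary: j k N)
  case (Lam s M)
  have "subst (lift 0 (lift j N)) (Suc (Suc k)) (lift (Suc j) M) =
    subst (lift (Suc j) (lift 0 N)) (Suc (Suc k)) (lift (Suc j) M)"
    by (simp add: lift_lift)
  with Lam show ?case by simp
qed auto

lemma subst_psubst: "subst N k (psubst g M) = psubst (\<lambda>i. subst N k (g i)) M"
proof (induction M arbitrary: N k g)
  case (Lam s M)
  have "(\<lambda>i. subst (lift 0 N) (Suc k) (up g i)) = up (\<lambda>i. subst N k (g i))"
    by (rule ext) (simp add: subst_lift_le split: nat.splits)
  with Lam show ?case by simp
qed auto

text \<open>Contracting a \<beta>-redex amounts to extending the simultaneous substitution at index
  0, just as an abstraction extends the environment to \<open>case_nat d e\<close>.\<close>

lemma subst_psubst_up: "subst N 0 (psubst (up g) M) = psubst (case_nat N g) M"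
proof -
  have "(\<lambda>i. subst N 0 (up g i)) = case_nat N g"
    by (rule ext) (simp add: subst_lift split: nat.splits)
  then show ?thesis by (simp add: subst_psubst)
qed

lemma psubst_Var: "psubst Var M = M"
proof (induction M)
  case (Lam s M)
  have "up Var = Var" by (rule ext) (simp split: nat.splits)
  with Lam show ?case by simp
qed auto

lemma red_star_App1: "red\<^sup>*\<^sup>* M M' \<Longrightarrow> red\<^sup>*\<^sup>* (M \<bullet> N) (M' \<bullet> N)"
  by (induction rule: rtranclp_induct) (auto intro: red.ctx_App1 rtranclp.rtrancl_into_rtrancl)

lemma red_star_App2: "red\<^sup>*\<^sup>* N N' \<Longrightarrow> red\<^sup>*\<^sup>* (M \<bullet> N) (M \<bullet> N')"
  by (induction rule: rtranclp_induct) (auto intro: red.ctx_App2 rtranclp.rtrancl_into_rtrancl)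

lemma red_star_App: "red\<^sup>*\<^sup>* M M' \<Longrightarrow> red\<^sup>*\<^sup>* N N' \<Longrightarrow> red\<^sup>*\<^sup>* (M \<bullet> N) (M' \<bullet> N')"
  using red_star_App1 red_star_App2 by (meson rtranclp_trans)


section \<open>Realizability of finite sets of primes\<close>

text \<open>For a set \<open>F\<close> of step primes, an argument containing
  \<open>fn_dom F\<close> triggers every step and so yields all of \<open>fn_ran F\<close>. This
  pair describes the joint behaviour of the steps.\<close>

definition fn_dom :: "prime set \<Rightarrow> prime set" where
  "fn_dom F = {x. \<exists>X b. Fn X b \<in> F \<and> x \<in> fset X}"

definition fn_ran :: "prime set \<Rightarrow> prime set" where
  "fn_ran F = {b. \<exists>X. Fn X b \<in> F}"

text \<open>The successor and the extra 0 give the empty set a strictly smaller measure than any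
  nonempty finite set, so a recursive call on an empty set of components still decreases.\<close>

definition max_size :: "prime set \<Rightarrow> nat" where
  "max_size d = Max (insert 0 ((\<lambda>p. Suc (size p)) ` d))"

lemma max_size_less:
  assumes "finite d" "d \<noteq> {}" "finite d'" "\<And>p. p \<in> d' \<Longrightarrow> \<exists>q\<in>d. size p < size q"
  shows "max_size d' < max_size d"
proof -
  have le: "Suc (size q) \<le> max_size d" if "q \<in> d" for q
    using assms(1) that by (auto simp: max_size_def)
  have "0 < max_size d" using le assms(2) by fastforce
  moreover have "Suc (size p) < max_size d" if "p \<in> d'" for p
    using assms(4)[OF that] le by fastforce
  ultimately show ?thesis using assms(3) by (simp add: max_size_def[of d'])
qed

lemma finite_fn_dom: "finite F \<Longrightarrow> finite (fn_dom F)"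
proof -
  have "fn_dom F \<subseteq> (\<Union>p\<in>F. case p of Fn X b \<Rightarrow> fset X | _ \<Rightarrow> {})"
    unfolding fn_dom_def by (auto intro: bexI[of _ "Fn _ _"])
  then show "finite F \<Longrightarrow> ?thesis" by (rule finite_subset) (auto split: prime.splits)
qed

lemma finite_fn_ran: "finite F \<Longrightarrow> finite (fn_ran F)"
proof -
  have "fn_ran F \<subseteq> (\<lambda>p. case p of Fn X b \<Rightarrow> b | _ \<Rightarrow> p) ` F"
    unfolding fn_ran_def by (auto intro: image_eqI[of _ _ "Fn _ _"])
  then show "finite F \<Longrightarrow> ?thesis" by (rule finite_subset) simp
qed

lemma finite_vimage:
  "finite d \<Longrightarrow> finite {a. Sum0 a \<in> d}" "finite d \<Longrightarrow> finite {a. Sum1 a \<in> d}"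
  "finite d \<Longrightarrow> finite {a. Left a \<in> d}" "finite d \<Longrightarrow> finite {a. Right a \<in> d}"
  by (simp_all add: finite_vimageI[unfolded vimage_def] inj_def)

lemma max_size_constructor:
  assumes "finite d" "d \<noteq> {}" "finite {a. c a \<in> d}" "\<And>a. size a < size (c a :: prime)"
  shows "max_size {a. c a \<in> d} < max_size d"
  using assms(1-3)
proof (rule max_size_less)
  fix a assume "a \<in> {a. c a \<in> d}"
  then have "c a \<in> d" by simp
  with assms(4) show "\<exists>q\<in>d. size a < size q" by (rule bexI)
qed

lemma max_size_vimage:
  "finite d \<Longrightarrow> d \<noteq> {} \<Longrightarrow> max_size {a. Sum0 a \<in> d} < max_size d"
  "finite d \<Longrightarrow> d \<noteq> {} \<Longrightarrow> max_size {a. Sum1 a \<in> d} < max_size d"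
  "finite d \<Longrightarrow> d \<noteq> {} \<Longrightarrow> max_size {a. Left a \<in> d} < max_size d"
  "finite d \<Longrightarrow> d \<noteq> {} \<Longrightarrow> max_size {a. Right a \<in> d} < max_size d"
  by (simp_all add: max_size_constructor finite_vimage)

lemma max_size_fn:
  assumes "finite d" "d \<noteq> {}" "F \<subseteq> d"
  shows "max_size (fn_dom F) < max_size d" "max_size (fn_ran F) < max_size d"
proof -
  have fin: "finite F" using assms finite_subset by blast
  have "\<exists>q\<in>d. size p < size q" if "p \<in> fn_dom F" for p
  proof -
    from that obtain X b where "Fn X b \<in> d" "p \<in> fset X" using assms(3) unfolding fn_dom_def by blast
    then show ?thesis using size_prime_Fn[of p X b] by (intro bexI[of _ "Fn X b"])
  qed
  then show "max_size (fn_dom F) < max_size d"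
    by (rule max_size_less[OF assms(1,2) finite_fn_dom[OF fin]])
  have "\<exists>q\<in>d. size p < size q" if p: "p \<in> fn_ran F" for p
  proof -
    from p obtain X where "Fn X p \<in> d" using assms(3) unfolding fn_ran_def by blast
    then show ?thesis by (rule bexI[rotated]) simp
  qed
  then show "max_size (fn_ran F) < max_size d"
    by (rule max_size_less[OF assms(1,2) finite_fn_ran[OF fin]])
qed

text \<open>\<open>realizes T M d\<close>: the term \<open>M\<close> has all the primes in \<open>d\<close> operationally. The set \<open>d\<close> is treated
  as a whole: one reduct of \<open>M\<close> has to serve all its primes at once, which makes confluence
  superfluous. Arguments of functions are tested on consistent sets only.
  The repeated premise \<open>finite d\<close> guards the recursive calls for the termination proof.\<close>

function realizes :: "ty_tree \<Rightarrow> tm \<Rightarrow> prime set \<Rightarrow> bool" where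
  "realizes T M d \<longleftrightarrow> finite d \<and> (\<forall>p\<in>d. prime_of T p) \<and> (finite d \<longrightarrow> d \<noteq> {} \<longrightarrow>
     (\<forall>A B. T = NSum A B \<longrightarrow>
        (Tag0 \<in> d \<or> {a. Sum0 a \<in> d} \<noteq> {} \<longrightarrow>
          (\<exists>a b M'. red\<^sup>*\<^sup>* M (Const (In0 a b) \<bullet> M') \<and> closed_ty a \<and> tree_of a = A \<and>
             realizes A M' {a. Sum0 a \<in> d})) \<and>
        (Tag1 \<in> d \<or> {b. Sum1 b \<in> d} \<noteq> {} \<longrightarrow>
          (\<exists>a b M'. red\<^sup>*\<^sup>* M (Const (In1 a b) \<bullet> M') \<and> closed_ty b \<and> tree_of b = B \<and>
             realizes B M' {b. Sum1 b \<in> d}))) \<and>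
     (\<forall>A B. T = NProd A B \<longrightarrow>
        (\<exists>a b M1 M2. red\<^sup>*\<^sup>* M (Const (Pair a b) \<bullet> M1 \<bullet> M2) \<and>
           closed_ty a \<and> tree_of a = A \<and> closed_ty b \<and> tree_of b = B \<and>
           realizes A M1 {a. Left a \<in> d} \<and> realizes B M2 {b. Right b \<in> d})) \<and>
     (\<forall>A B. T = NFun A B \<longrightarrow>
        (\<forall>N F. F \<subseteq> d \<longrightarrow> consistent (fn_dom F) \<longrightarrow> realizes A N (fn_dom F) \<longrightarrow>
           realizes B (M \<bullet> N) (fn_ran F))))"
  by pat_completeness auto
termination
  by (relation "measure (\<lambda>(T, M, d). max_size d)") (auto simp: max_size_vimage max_size_fn)

declare realizes.simps [simp del]

lemma realizes_finite: "realizes T M d \<Longrightarrow> finite d"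
  by (rule realizes.simps[THEN iffD1, THEN conjunct1])

lemma realizes_prime_of: "realizes T M d \<Longrightarrow> p \<in> d \<Longrightarrow> prime_of T p"
  by (rule bspec[OF realizes.simps[THEN iffD1, THEN conjunct2, THEN conjunct1]])

lemma realizes_empty: "realizes T M {}"
  by (subst realizes.simps) simp

lemma realizes_NVoid: "realizes NVoid M d \<longleftrightarrow> d = {}"
  by (subst realizes.simps) auto

lemma realizes_NSum:
  "realizes (NSum A B) M d \<longleftrightarrow> finite d \<and> (\<forall>p\<in>d. prime_of (NSum A B) p) \<and>
     (Tag0 \<in> d \<or> {a. Sum0 a \<in> d} \<noteq> {} \<longrightarrow>
       (\<exists>a b M'. red\<^sup>*\<^sup>* M (Const (In0 a b) \<bullet> M') \<and> closed_ty a \<and> tree_of a = A \<and>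
          realizes A M' {a. Sum0 a \<in> d})) \<and>
     (Tag1 \<in> d \<or> {b. Sum1 b \<in> d} \<noteq> {} \<longrightarrow>
       (\<exists>a b M'. red\<^sup>*\<^sup>* M (Const (In1 a b) \<bullet> M') \<and> closed_ty b \<and> tree_of b = B \<and>
          realizes B M' {b. Sum1 b \<in> d}))"
  by (subst realizes.simps, cases "d = {}"; cases "finite d") (simp_all del: prime_of_NSum)

lemma realizes_NProd:
  "realizes (NProd A B) M d \<longleftrightarrow> finite d \<and> (\<forall>p\<in>d. prime_of (NProd A B) p) \<and>
     (d \<noteq> {} \<longrightarrow> (\<exists>a b M1 M2. red\<^sup>*\<^sup>* M (Const (Pair a b) \<bullet> M1 \<bullet> M2) \<and>
        closed_ty a \<and> tree_of a = A \<and> closed_ty b \<and> tree_of b = B \<and>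
        realizes A M1 {a. Left a \<in> d} \<and> realizes B M2 {b. Right b \<in> d}))"
  by (subst realizes.simps, cases "d = {}"; cases "finite d") (simp_all del: prime_of_NProd)

lemma fn_ran_empty [simp]: "fn_ran {} = {}"
  by (simp add: fn_ran_def)

lemma realizes_NFun:
  "realizes (NFun A B) M d \<longleftrightarrow> finite d \<and> (\<forall>p\<in>d. prime_of (NFun A B) p) \<and>
     (\<forall>N F. F \<subseteq> d \<longrightarrow> consistent (fn_dom F) \<longrightarrow> realizes A N (fn_dom F) \<longrightarrow>
        realizes B (M \<bullet> N) (fn_ran F))"
  by (subst realizes.simps, cases "d = {}"; cases "finite d") (simp_all add: realizes_empty del: prime_of_NFun)

text \<open>Sums and products ask only for some reduct, so they are immediate; at function type the
  reduction is carried through the application and the induction on primes takes over.\<close>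

lemma realizes_expand: "realizes T M' d \<Longrightarrow> red\<^sup>*\<^sup>* M M' \<Longrightarrow> realizes T M d"
proof (induction "max_size d" arbitrary: T M M' d rule: less_induct)
  case less
  have fin: "finite d" using less.prems(1) by (rule realizes_finite)
  have trans: "red\<^sup>*\<^sup>* M N" if "red\<^sup>*\<^sup>* M' N" for N using less.prems(2) that by (rule rtranclp_trans)
  show ?case
  proof (cases T)
    case NVoid
    then show ?thesis using less.prems by (simp add: realizes_NVoid)
  next
    case (NSum A B)
    then show ?thesis using less.prems(1) trans unfolding NSum realizes_NSum by blast
  next
    case (NProd A B)
    then show ?thesis using less.prems(1) trans unfolding NProd realizes_NProd by blast
  next
    case (NFun A B)
    have "realizes B (M \<bullet> N) (fn_ran F)"
      if F: "F \<subseteq> d" "consistent (fn_dom F)" "realizes A N (fn_dom F)" for N F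
    proof (cases "d = {}")
      case True
      then show ?thesis using F by (simp add: realizes_empty)
    next
      case False
      have "realizes B (M' \<bullet> N) (fn_ran F)"
        using less.prems(1) F unfolding NFun realizes_NFun by blast
      then show ?thesis
        using less.hyps[OF max_size_fn(2)[OF fin False F(1)]] red_star_App1[OF less.prems(2)] by blast
    qed
    then show ?thesis using less.prems(1) unfolding NFun realizes_NFun by blast
  qed
qed

lemma ple_left_iff:
  "ple Tag0 q \<longleftrightarrow> q = Tag0 \<or> (\<exists>b. q = Sum0 b)"
  "ple Tag1 q \<longleftrightarrow> q = Tag1 \<or> (\<exists>b. q = Sum1 b)"
  "ple (Sum0 a) q \<longleftrightarrow> (\<exists>b. q = Sum0 b \<and> ple a b)"
  "ple (Sum1 a) q \<longleftrightarrow> (\<exists>b. q = Sum1 b \<and> ple a b)"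
  "ple (Left a) q \<longleftrightarrow> (\<exists>b. q = Left b \<and> ple a b)"
  "ple (Right a) q \<longleftrightarrow> (\<exists>b. q = Right b \<and> ple a b)"
  "ple (Fn X a) q \<longleftrightarrow> (\<exists>Y b. q = Fn Y b \<and> (\<forall>y\<in>fset Y. \<exists>x\<in>fset X. ple y x) \<and> ple a b)"
  by (cases q; auto)+

text \<open>Since \<open>Tag0\<close> lies below every \<open>Sum0 a\<close> and the sets are not
  downward closed, a set may witness the tag through a component alone. Hence the disjunction in the
  last two claims, as in the sum clause of \<open>realizes\<close>.\<close>

lemma below_vimage:
  assumes "below Y X"
  shows "below {a. Sum0 a \<in> Y} {a. Sum0 a \<in> X}" "below {a. Sum1 a \<in> Y} {a. Sum1 a \<in> X}"
    "below {a. Left a \<in> Y} {a. Left a \<in> X}" "below {a. Right a \<in> Y} {a. Right a \<in> X}"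
    "Tag0 \<in> Y \<or> {a. Sum0 a \<in> Y} \<noteq> {} \<Longrightarrow> Tag0 \<in> X \<or> {a. Sum0 a \<in> X} \<noteq> {}"
    "Tag1 \<in> Y \<or> {a. Sum1 a \<in> Y} \<noteq> {} \<Longrightarrow> Tag1 \<in> X \<or> {a. Sum1 a \<in> X} \<noteq> {}"
  using assms unfolding below_def by (fastforce simp: ple_left_iff)+

text \<open>At function type a realizer of the arguments in \<open>Y\<close> must be turned into one
  of the arguments in \<open>X\<close>, so the two sets change places; the sum of their measures
  decreases all the same.\<close>

lemma realizes_below:
  "realizes T M X \<Longrightarrow> finite Y \<Longrightarrow> (\<forall>y\<in>Y. prime_of T y) \<Longrightarrow> below Y X \<Longrightarrow> realizes T M Y"
proof (induction "max_size X + max_size Y" arbitrary: T M X Y rule: less_induct)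
  case less
  have finX: "finite X" using less.prems(1) by (rule realizes_finite)
  have primesX: "\<forall>x\<in>X. prime_of T x" using less.prems(1) realizes_prime_of by blast
  have IH: "realizes T' M' Y'" if "realizes T' M' X'" "max_size X' < max_size X" "max_size Y' < max_size Y"
    "finite Y'" "\<forall>y\<in>Y'. prime_of T' y" "below Y' X'" for T' M' X' Y'
    using less.hyps[of X' Y' T' M'] that by simp
  \<comment> \<open>The induction hypothesis with the measures crossed, for the contravariant
    argument position.\<close>
  have IH': "realizes T' M' Y'" if "realizes T' M' X'" "max_size X' < max_size Y" "max_size Y' < max_size X"
    "finite Y'" "\<forall>y\<in>Y'. prime_of T' y" "below Y' X'" for T' M' X' Y'
    using less.hyps[of X' Y' T' M'] that by simp
  show ?case
  proof (cases "Y = {}")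
    case True
    then show ?thesis by (simp add: realizes_empty)
  next
    case False
    then have X: "X \<noteq> {}" using less.prems(4) unfolding below_def by blast
    note szX = max_size_vimage[OF finX X] max_size_fn[OF finX X]
      and szY = max_size_vimage[OF less.prems(2) False] max_size_fn[OF less.prems(2) False]
      and finY = finite_vimage[OF less.prems(2)] and bl = below_vimage[OF less.prems(4)]
    show ?thesis
    proof (cases T)
      case NVoid
      then show ?thesis using less.prems False by simp
    next
      case (NSum A B)
      have p: "\<forall>y\<in>{a. Sum0 a \<in> Y}. prime_of A y" "\<forall>y\<in>{a. Sum1 a \<in> Y}. prime_of B y"
        using less.prems(3) NSum by auto
      note R = less.prems(1)[unfolded NSum realizes_NSum]
      have "\<exists>a b M'. red\<^sup>*\<^sup>* M (Const (In0 a b) \<bullet> M') \<and> closed_ty a \<and> tree_of a = A \<and>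
        realizes A M' {a. Sum0 a \<in> Y}" if Y: "Tag0 \<in> Y \<or> {a. Sum0 a \<in> Y} \<noteq> {}"
      proof -
        obtain a b M' where M': "red\<^sup>*\<^sup>* M (Const (In0 a b) \<bullet> M')" "closed_ty a" "tree_of a = A"
          "realizes A M' {a. Sum0 a \<in> X}" using R bl(5)[OF Y] by blast
        then show ?thesis using IH[OF M'(4) szX(1) szY(1) finY(1) p(1) bl(1)] by blast
      qed
      moreover have "\<exists>a b M'. red\<^sup>*\<^sup>* M (Const (In1 a b) \<bullet> M') \<and> closed_ty b \<and> tree_of b = B \<and>
        realizes B M' {a. Sum1 a \<in> Y}" if Y: "Tag1 \<in> Y \<or> {a. Sum1 a \<in> Y} \<noteq> {}"
      proof -
        obtain a b M' where M': "red\<^sup>*\<^sup>* M (Const (In1 a b) \<bullet> M')" "closed_ty b" "tree_of b = B"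
          "realizes B M' {a. Sum1 a \<in> X}" using R bl(6)[OF Y] by blast
        then show ?thesis using IH[OF M'(4) szX(2) szY(2) finY(2) p(2) bl(2)] by blast
      qed
      ultimately show ?thesis using less.prems(2,3) unfolding NSum realizes_NSum by blast
    next
      case (NProd A B)
      have p: "\<forall>y\<in>{a. Left a \<in> Y}. prime_of A y" "\<forall>y\<in>{a. Right a \<in> Y}. prime_of B y"
        using less.prems(3) NProd by auto
      obtain a b M1 M2 where M: "red\<^sup>*\<^sup>* M (Const (Pair a b) \<bullet> M1 \<bullet> M2)"
        "closed_ty a" "tree_of a = A" "closed_ty b" "tree_of b = B"
        "realizes A M1 {a. Left a \<in> X}" "realizes B M2 {a. Right a \<in> X}"
        using less.prems(1)[unfolded NProd realizes_NProd] X by blast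
      have "realizes A M1 {a. Left a \<in> Y}" "realizes B M2 {a. Right a \<in> Y}"
        using IH[OF M(6) szX(3) szY(3) finY(3) p(1) bl(3)]
          IH[OF M(7) szX(4) szY(4) finY(4) p(2) bl(4)] by blast+
      then show ?thesis using less.prems(2,3) M unfolding NProd realizes_NProd by blast
    next
      case (NFun A B)
      have "realizes B (M \<bullet> N) (fn_ran F)"
        if F: "F \<subseteq> Y" "consistent (fn_dom F)" "realizes A N (fn_dom F)" for N F
      proof -
        \<comment> \<open>The primes of \<open>X\<close> above some prime of \<open>F\<close>. Their
          results dominate those of \<open>F\<close>, while their arguments lie below those of
          \<open>F\<close>, so \<open>N\<close> realizes these arguments too.\<close>
        define F' where "F' = {q \<in> X. \<exists>p\<in>F. ple p q}"
        have F': "F' \<subseteq> X" by (auto simp: F'_def)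
        have dom: "below (fn_dom F') (fn_dom F)"
          unfolding below_def
        proof
          fix y assume "y \<in> fn_dom F'"
          then obtain Z b p where Z: "Fn Z b \<in> X" "p \<in> F" "ple p (Fn Z b)" "y \<in> fset Z"
            by (auto simp: fn_dom_def F'_def)
          moreover obtain W a where "p = Fn W a" using Z(3) by (cases p) auto
          ultimately show "\<exists>x\<in>fn_dom F. ple y x" by (fastforce simp: fn_dom_def)
        qed
        have ran: "below (fn_ran F) (fn_ran F')"
          unfolding below_def
        proof
          fix a assume "a \<in> fn_ran F"
          then obtain W where W: "Fn W a \<in> F" by (auto simp: fn_ran_def)
          then obtain q where q: "q \<in> X" "ple (Fn W a) q" using F(1) less.prems(4) by (auto simp: below_def)
          then obtain Z b where "q = Fn Z b" "ple a b" by (auto simp: ple_left_iff)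
          with W q show "\<exists>b\<in>fn_ran F'. ple a b" unfolding fn_ran_def F'_def by blast
        qed
        have "finite F'" "finite F" using F' F(1) finX less.prems(2) by (blast intro: finite_subset)+
        note fin = finite_fn_dom[OF this(1)] finite_fn_ran[OF this(2)]
        have "\<forall>x\<in>fn_dom F'. prime_of A x" using primesX F' unfolding NFun by (fastforce simp: fn_dom_def)
        then have "realizes A N (fn_dom F')"
          by (rule IH'[OF F(3) szY(5)[OF F(1)] szX(5)[OF F'] fin(1) _ dom])
        then have "realizes B (M \<bullet> N) (fn_ran F')"
          using less.prems(1) F' consistent_below[OF F(2) dom] unfolding NFun realizes_NFun by blast
        moreover have "\<forall>b\<in>fn_ran F. prime_of B b"
          using less.prems(3) F(1) unfolding NFun by (fastforce simp: fn_ran_def)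
        ultimately show ?thesis
          using IH[OF _ szX(6)[OF F'] szY(6)[OF F(1)] fin(2) _ ran] by blast
      qed
      then show ?thesis using less.prems(2,3) unfolding NFun realizes_NFun by blast
    qed
  qed
qed

text \<open>The scrutinee stays arbitrary: \<open>pcase\<close> moves past the common outer
  constructor of the branches, or takes in an argument at function type, until the induction
  hypothesis applies. At sums and products the contractum takes its annotations from the first
  branch, which is why \<open>realizes\<close> records that they are closed with the right
  tree.\<close>

lemma realizes_pcase:
  "realizes T M d \<Longrightarrow> realizes T N d \<Longrightarrow> closed_ty r \<Longrightarrow> tree_of r = T \<Longrightarrow>
   realizes T (Const (Pcase s t r) \<bullet> x \<bullet> M \<bullet> N) d"
proof (induction "max_size d" arbitrary: T M N d r rule: less_induct)
  case less
  have fin: "finite d" using less.prems(1) by (rule realizes_finite)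
  have primes: "\<forall>p\<in>d. prime_of T p" using less.prems(1) realizes_prime_of by blast
  have ctx: "red\<^sup>*\<^sup>* (Const (Pcase s t r) \<bullet> x \<bullet> M \<bullet> N) K"
    if "red\<^sup>*\<^sup>* M M'" "red\<^sup>*\<^sup>* N N'" "red (Const (Pcase s t r) \<bullet> x \<bullet> M' \<bullet> N') K" for M' N' K
    using red_star_App[OF red_star_App2[OF that(1)] that(2)] that(3) by (rule rtranclp.rtrancl_into_rtrancl)
  show ?case
  proof (cases "d = {}")
    case True
    then show ?thesis by (simp add: realizes_empty)
  next
    case False
    note sz = max_size_vimage[OF fin False] max_size_fn[OF fin False]
    show ?thesis
    proof (cases T)
      case NVoid
      then show ?thesis using less.prems by (simp add: realizes_NVoid)
    next
      case (NSum A B)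
      note M = less.prems(1)[unfolded NSum realizes_NSum]
        and N = less.prems(2)[unfolded NSum realizes_NSum]
      have "\<exists>a b K. red\<^sup>*\<^sup>* (Const (Pcase s t r) \<bullet> x \<bullet> M \<bullet> N) (Const (In0 a b) \<bullet> K) \<and>
        closed_ty a \<and> tree_of a = A \<and> realizes A K {a. Sum0 a \<in> d}"
        if d: "Tag0 \<in> d \<or> {a. Sum0 a \<in> d} \<noteq> {}"
      proof -
        obtain a b M' where M': "red\<^sup>*\<^sup>* M (Const (In0 a b) \<bullet> M')" "closed_ty a" "tree_of a = A"
          "realizes A M' {a. Sum0 a \<in> d}" using M d by blast
        obtain a' b' N' where N': "red\<^sup>*\<^sup>* N (Const (In0 a' b') \<bullet> N')"
          "realizes A N' {a. Sum0 a \<in> d}" using N d by blast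
        show ?thesis
          using ctx[OF M'(1) N'(1) red.pcase_00] M'(2,3) less.hyps[OF sz(1) M'(4) N'(2) M'(2,3)] by blast
      qed
      moreover have "\<exists>a b K. red\<^sup>*\<^sup>* (Const (Pcase s t r) \<bullet> x \<bullet> M \<bullet> N) (Const (In1 a b) \<bullet> K) \<and>
        closed_ty b \<and> tree_of b = B \<and> realizes B K {a. Sum1 a \<in> d}"
        if d: "Tag1 \<in> d \<or> {a. Sum1 a \<in> d} \<noteq> {}"
      proof -
        obtain a b M' where M': "red\<^sup>*\<^sup>* M (Const (In1 a b) \<bullet> M')" "closed_ty b" "tree_of b = B"
          "realizes B M' {a. Sum1 a \<in> d}" using M d by blast
        obtain a' b' N' where N': "red\<^sup>*\<^sup>* N (Const (In1 a' b') \<bullet> N')"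
          "realizes B N' {a. Sum1 a \<in> d}" using N d by blast
        show ?thesis
          using ctx[OF M'(1) N'(1) red.pcase_11] M'(2,3) less.hyps[OF sz(2) M'(4) N'(2) M'(2,3)] by blast
      qed
      ultimately show ?thesis using fin primes unfolding NSum realizes_NSum by blast
    next
      case (NProd A B)
      obtain a b M1 M2 where M: "red\<^sup>*\<^sup>* M (Const (Pair a b) \<bullet> M1 \<bullet> M2)"
        "closed_ty a" "tree_of a = A" "closed_ty b" "tree_of b = B"
        "realizes A M1 {a. Left a \<in> d}" "realizes B M2 {a. Right a \<in> d}"
        using less.prems(1)[unfolded NProd realizes_NProd] False by blast
      obtain a' b' N1 N2 where N: "red\<^sup>*\<^sup>* N (Const (Pair a' b') \<bullet> N1 \<bullet> N2)"
        "realizes A N1 {a. Left a \<in> d}" "realizes B N2 {a. Right a \<in> d}"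
        using less.prems(2)[unfolded NProd realizes_NProd] False by blast
      show ?thesis
        using ctx[OF M(1) N(1) red.pcase_pair] M(2-5) fin primes
          less.hyps[OF sz(3) M(6) N(2) M(2,3)] less.hyps[OF sz(4) M(7) N(3) M(4,5)]
        unfolding NProd realizes_NProd by blast
    next
      case (NFun A B)
      obtain a b where r: "closed_ty a" "closed_ty b" "tree_of b = B" "r \<approx> TFun a b"
        using less.prems(3,4) NFun by (blast elim: tree_of_NFunE)
      have "realizes B (Const (Pcase s t r) \<bullet> x \<bullet> M \<bullet> N \<bullet> K) (fn_ran F)"
        if F: "F \<subseteq> d" "consistent (fn_dom F)" "realizes A K (fn_dom F)" for K F
      proof -
        have "realizes B (M \<bullet> K) (fn_ran F)" "realizes B (N \<bullet> K) (fn_ran F)"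
          using less.prems(1,2) F unfolding NFun realizes_NFun by blast+
        then have "realizes B (Const (Pcase s t b) \<bullet> x \<bullet> (M \<bullet> K) \<bullet> (N \<bullet> K)) (fn_ran F)"
          using less.hyps[OF sz(6)[OF F(1)]] r by blast
        then show ?thesis
          using red.pcase_app[OF r(4,1,2)] by (rule realizes_expand[OF _ r_into_rtranclp])
      qed
      then show ?thesis using fin primes unfolding NFun realizes_NFun by blast
    qed
  qed
qed

section \<open>Adequacy: from finite sets of primes to denotations\<close>

definition adequate :: "ty_tree \<Rightarrow> tm \<Rightarrow> prime set \<Rightarrow> bool" where
  "adequate T M d \<longleftrightarrow> (\<forall>X. finite X \<longrightarrow> X \<subseteq> d \<longrightarrow> realizes T M X)"

lemma adequate_expand: "adequate T M' d \<Longrightarrow> red\<^sup>*\<^sup>* M M' \<Longrightarrow> adequate T M d"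
  unfolding adequate_def using realizes_expand by blast

text \<open>Turns a test on a finite set into one on the point it generates, where the denotation of
  an abstraction is evaluated.\<close>

lemma adequate_gen:
  assumes "realizes T M X"
  shows "adequate T M (gen T X)"
  unfolding adequate_def
proof (intro allI impI)
  fix Y assume Y: "finite Y" "Y \<subseteq> gen T X"
  then show "realizes T M Y"
    by (intro realizes_below[OF assms]) (auto simp: gen_def below_def)
qed

text \<open>Choosing a single step prime for each prime of \<open>X\<close> keeps the set of steps
  finite and its range exactly \<open>X\<close>.\<close>

lemma fn_app_finite:
  assumes "finite X" "X \<subseteq> fn_app f d"
  obtains F where "F \<subseteq> f" "finite F" "fn_ran F = X" "fn_dom F \<subseteq> d"
proof -
  have "\<forall>b\<in>X. \<exists>Z. Fn Z b \<in> f \<and> fset Z \<subseteq> d" using assms(2) unfolding fn_app_def by blast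
  then obtain c where c: "\<forall>b\<in>X. Fn (c b) b \<in> f \<and> fset (c b) \<subseteq> d" by metis
  show ?thesis
  proof (rule that[of "(\<lambda>b. Fn (c b) b) ` X"])
    show "fn_dom ((\<lambda>b. Fn (c b) b) ` X) \<subseteq> d" using c unfolding fn_dom_def by blast
    show "fn_ran ((\<lambda>b. Fn (c b) b) ` X) = X" unfolding fn_ran_def by blast
  qed (use c assms(1) in auto)
qed

text \<open>The argument term \<open>N'\<close> may depend on the finite set \<open>Y\<close>. For
  \<open>case\<close> it is the component of a reduct of the scrutinee, and different finite parts
  of a denotation may be realized through different reducts.\<close>

lemma realizes_App:
  assumes f: "adequate (NFun A B) M f" and "finite X" "X \<subseteq> fn_app f d" "consistent d"
    and N: "\<And>Y. finite Y \<Longrightarrow> Y \<subseteq> d \<Longrightarrow> \<exists>N'. red\<^sup>*\<^sup>* K (M \<bullet> N') \<and> realizes A N' Y"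
  shows "realizes B K X"
proof -
  obtain F where F: "F \<subseteq> f" "finite F" "fn_ran F = X" "fn_dom F \<subseteq> d"
    using assms(2,3) by (rule fn_app_finite)
  obtain N' where N': "red\<^sup>*\<^sup>* K (M \<bullet> N')" "realizes A N' (fn_dom F)"
    using N[OF finite_fn_dom[OF F(2)] F(4)] by blast
  have "realizes (NFun A B) M F" using f F unfolding adequate_def by blast
  then have "realizes B (M \<bullet> N') X"
    using F(3) N'(2) consistent_subset[OF assms(4) F(4)] unfolding realizes_NFun by blast
  then show ?thesis using N'(1) by (rule realizes_expand)
qed

lemma adequate_App:
  assumes "adequate (NFun A B) M f" "adequate A N d" "d \<in> points A"
  shows "adequate B (M \<bullet> N) (fn_app f d)"
  unfolding adequate_def
proof (intro allI impI)
  fix X assume X: "finite X" "X \<subseteq> fn_app f d"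
  show "realizes B (M \<bullet> N) X"
    using assms(1) X points_consistent[OF assms(3)]
  proof (rule realizes_App)
    show "\<exists>N'. red\<^sup>*\<^sup>* (M \<bullet> N) (M \<bullet> N') \<and> realizes A N' Y" if "finite Y" "Y \<subseteq> d" for Y
      using assms(2) that unfolding adequate_def by blast
  qed
qed

text \<open>A term realizing the arguments of finitely many step primes is adequate for the point
  they generate; there the value of \<open>f\<close> contains all the results. Consistency of the
  arguments, built into \<open>realizes\<close>, is what makes them generate a point.\<close>

lemma adequate_abs:
  assumes f: "contin A B f"
    and app: "\<And>N d. d \<in> points A \<Longrightarrow> adequate A N d \<Longrightarrow> adequate B (M \<bullet> N) (f d)"
  shows "adequate (NFun A B) M (tree_abs A f)"
  unfolding adequate_def realizes_NFun
proof (intro allI impI conjI ballI)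
  fix X assume X: "finite X" "X \<subseteq> tree_abs A f"
  show "finite X" by (rule X(1))
  show "prime_of (NFun A B) p" if "p \<in> X" for p
    using points_prime_of[OF contin_points[OF f]] X(2) that by blast
  fix N F assume F: "F \<subseteq> X" "consistent (fn_dom F)" "realizes A N (fn_dom F)"
  have mono: "mono_points A f" using f unfolding contin_def by simp
  have "fn_ran F \<subseteq> f (gen A (fn_dom F))"
  proof
    fix b assume "b \<in> fn_ran F"
    then obtain Z where Z: "Fn Z b \<in> F" by (auto simp: fn_ran_def)
    then have "Fn Z b \<in> tree_abs A f" using F(1) X(2) by blast
    then have b: "b \<in> f (gen A (fset Z))" by (auto simp: tree_abs_def)
    have Z: "fset Z \<subseteq> fn_dom F" using Z unfolding fn_dom_def by blast
    have "f (gen A (fset Z)) \<subseteq> f (gen A (fn_dom F))"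
      by (rule mono_pointsD[OF mono gen_points gen_points gen_mono])
        (use Z F(2) consistent_subset below_subset in blast)+
    with b show "b \<in> f (gen A (fn_dom F))" by blast
  qed
  moreover have "adequate B (M \<bullet> N) (f (gen A (fn_dom F)))"
    using app[OF gen_points[OF F(2)] adequate_gen[OF F(3)]] .
  moreover have "finite (fn_ran F)" using finite_fn_ran finite_subset[OF F(1) X(1)] by blast
  ultimately show "realizes B (M \<bullet> N) (fn_ran F)" unfolding adequate_def by blast
qed

lemma adequate_inj0:
  assumes d: "d \<in> points A" "adequate A N d" and a: "closed_ty a" "tree_of a = A"
  shows "adequate (NSum A B) (Const (In0 a b) \<bullet> N) (inj0 d)"
  unfolding adequate_def
proof (intro allI impI)
  fix X assume X: "finite X" "X \<subseteq> inj0 d"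
  have 1: "\<forall>p\<in>X. prime_of (NSum A B) p" using points_prime_of[OF inj0_points[OF d(1)]] X(2) by blast
  have "{a. Sum0 a \<in> X} \<subseteq> d" using X(2) by (auto simp: inj0_def)
  then have 2: "realizes A N {a. Sum0 a \<in> X}"
    using d(2) finite_vimage(1)[OF X(1)] unfolding adequate_def by blast
  have 3: "\<not> (Tag1 \<in> X \<or> {b. Sum1 b \<in> X} \<noteq> {})" using X(2) by (auto simp: inj0_def)
  show "realizes (NSum A B) (Const (In0 a b) \<bullet> N) X"
    unfolding realizes_NSum using X(1) 1 2 3 a by blast
qed

lemma adequate_inj1:
  assumes d: "d \<in> points B" "adequate B N d" and b: "closed_ty b" "tree_of b = B"
  shows "adequate (NSum A B) (Const (In1 a b) \<bullet> N) (inj1 d)"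
  unfolding adequate_def
proof (intro allI impI)
  fix X assume X: "finite X" "X \<subseteq> inj1 d"
  have 1: "\<forall>p\<in>X. prime_of (NSum A B) p" using points_prime_of[OF inj1_points[OF d(1)]] X(2) by blast
  have "{a. Sum1 a \<in> X} \<subseteq> d" using X(2) by (auto simp: inj1_def)
  then have 2: "realizes B N {a. Sum1 a \<in> X}"
    using d(2) finite_vimage(2)[OF X(1)] unfolding adequate_def by blast
  have 3: "\<not> (Tag0 \<in> X \<or> {b. Sum0 b \<in> X} \<noteq> {})" using X(2) by (auto simp: inj1_def)
  show "realizes (NSum A B) (Const (In1 a b) \<bullet> N) X"
    unfolding realizes_NSum using X(1) 1 2 3 b by blast
qed

lemma adequate_pair:
  assumes d: "d \<in> points A" "adequate A M d" and e: "e \<in> points B" "adequate B N e"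
    and ab: "closed_ty a" "tree_of a = A" "closed_ty b" "tree_of b = B"
  shows "adequate (NProd A B) (Const (Pair a b) \<bullet> M \<bullet> N) (pair_val d e)"
  unfolding adequate_def
proof (intro allI impI)
  fix X assume X: "finite X" "X \<subseteq> pair_val d e"
  have 1: "\<forall>p\<in>X. prime_of (NProd A B) p"
    using points_prime_of[OF pair_val_points[OF d(1) e(1)]] X(2) by blast
  have "{a. Left a \<in> X} \<subseteq> d" "{a. Right a \<in> X} \<subseteq> e" using X(2) by (auto simp: pair_val_def)
  then have "realizes A M {a. Left a \<in> X}" "realizes B N {a. Right a \<in> X}"
    using d(2) e(2) finite_vimage(3,4)[OF X(1)] unfolding adequate_def by blast+
  then show "realizes (NProd A B) (Const (Pair a b) \<bullet> M \<bullet> N) X"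
    unfolding realizes_NProd using X(1) 1 ab by blast
qed

lemma adequate_fst:
  assumes "adequate (NProd A B) M d"
  shows "adequate A (Const (Fst s t) \<bullet> M) (fst_val d)"
  unfolding adequate_def
proof (intro allI impI)
  fix X assume X: "finite X" "X \<subseteq> fst_val d"
  show "realizes A (Const (Fst s t) \<bullet> M) X"
  proof (cases "X = {}")
    case False
    \<comment> \<open>Tagging the primes of \<open>X\<close> with \<open>Left\<close> demands
      nothing but first components from \<open>M\<close>; as \<open>X\<close> is nonempty, a pair
      must appear.\<close>
    have "realizes (NProd A B) M (Left ` X)"
      using assms X unfolding adequate_def fst_val_def by blast
    then obtain a b M1 M2 where M: "red\<^sup>*\<^sup>* M (Const (Pair a b) \<bullet> M1 \<bullet> M2)"
      "realizes A M1 {a. Left a \<in> Left ` X}"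
      using False unfolding realizes_NProd by blast
    have "{a. Left a \<in> Left ` X} = X" by auto
    then have "realizes A M1 X" using M(2) by simp
    moreover have "red\<^sup>*\<^sup>* (Const (Fst s t) \<bullet> M) M1"
      using red_star_App2[OF M(1)] red.fst_pair by (rule rtranclp.rtrancl_into_rtrancl)
    ultimately show ?thesis by (rule realizes_expand)
  qed (simp add: realizes_empty)
qed

lemma adequate_snd:
  assumes "adequate (NProd A B) M d"
  shows "adequate B (Const (Snd s t) \<bullet> M) (snd_val d)"
  unfolding adequate_def
proof (intro allI impI)
  fix X assume X: "finite X" "X \<subseteq> snd_val d"
  show "realizes B (Const (Snd s t) \<bullet> M) X"
  proof (cases "X = {}")
    case False
    have "realizes (NProd A B) M (Right ` X)"
      using assms X unfolding adequate_def snd_val_def by blast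
    then obtain a b M1 M2 where M: "red\<^sup>*\<^sup>* M (Const (Pair a b) \<bullet> M1 \<bullet> M2)"
      "realizes B M2 {a. Right a \<in> Right ` X}"
      using False unfolding realizes_NProd by blast
    have "{a. Right a \<in> Right ` X} = X" by auto
    then have "realizes B M2 X" using M(2) by simp
    moreover have "red\<^sup>*\<^sup>* (Const (Snd s t) \<bullet> M) M2"
      using red_star_App2[OF M(1)] red.snd_pair by (rule rtranclp.rtrancl_into_rtrancl)
    ultimately show ?thesis by (rule realizes_expand)
  qed (simp add: realizes_empty)
qed

text \<open>Asking for the tag together with the components forces one reduct to serve both; with
  \<open>Y\<close> empty the tag alone already yields the injection.\<close>

lemma adequate_Tag0:
  assumes "adequate (NSum A B) M x" "Tag0 \<in> x" "finite Y" "Sum0 ` Y \<subseteq> x"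
  obtains a b M' where "red\<^sup>*\<^sup>* M (Const (In0 a b) \<bullet> M')" "realizes A M' Y"
proof -
  have "realizes (NSum A B) M (insert Tag0 (Sum0 ` Y))" using assms unfolding adequate_def by simp
  then obtain a b M' where M': "red\<^sup>*\<^sup>* M (Const (In0 a b) \<bullet> M')"
    "realizes A M' {a. Sum0 a \<in> insert Tag0 (Sum0 ` Y)}" unfolding realizes_NSum by blast
  have "{a. Sum0 a \<in> insert Tag0 (Sum0 ` Y)} = Y" by auto
  with M' that show ?thesis by simp
qed

lemma adequate_Tag1:
  assumes "adequate (NSum A B) M x" "Tag1 \<in> x" "finite Y" "Sum1 ` Y \<subseteq> x"
  obtains a b M' where "red\<^sup>*\<^sup>* M (Const (In1 a b) \<bullet> M')" "realizes B M' Y"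
proof -
  have "realizes (NSum A B) M (insert Tag1 (Sum1 ` Y))" using assms unfolding adequate_def by simp
  then obtain a b M' where M': "red\<^sup>*\<^sup>* M (Const (In1 a b) \<bullet> M')"
    "realizes B M' {a. Sum1 a \<in> insert Tag1 (Sum1 ` Y)}" unfolding realizes_NSum by blast
  have "{a. Sum1 a \<in> insert Tag1 (Sum1 ` Y)} = Y" by auto
  with M' that show ?thesis by simp
qed

text \<open>The reduct of the scrutinee is chosen for the finite part of its component that the
  branch consumes. Hence the appeal to \<open>realizes_App\<close>; \<open>adequate_App\<close>
  would want one argument term for the whole component.\<close>

lemma adequate_case:
  assumes x: "x \<in> points (NSum A B)" "adequate (NSum A B) M x"
    and f: "adequate (NFun A C) N f" and g: "adequate (NFun B C) P g"
  shows "adequate C (Const (Case s t r) \<bullet> M \<bullet> N \<bullet> P) (case_val x f g)" (is "adequate C ?K _")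
  unfolding adequate_def
proof (intro allI impI)
  fix X assume X: "finite X" "X \<subseteq> case_val x f g"
  have ctx: "red\<^sup>*\<^sup>* ?K K" if "red\<^sup>*\<^sup>* M M'" "red (Const (Case s t r) \<bullet> M' \<bullet> N \<bullet> P) K" for M' K
    using red_star_App1[OF red_star_App1[OF red_star_App2[OF that(1)]]] that(2)
    by (rule rtranclp.rtrancl_into_rtrancl)
  consider "Tag0 \<in> x" | "Tag0 \<notin> x" "Tag1 \<in> x" | "X = {}"
    using X(2) by (auto simp: case_val_def split: if_splits)
  then show "realizes C ?K X"
  proof cases
    case 1
    then have "X \<subseteq> fn_app f {e. Sum0 e \<in> x}" using X(2) by (simp add: case_val_def)
    with f X(1) show ?thesis using points_consistent[OF Sum0_points[OF x(1)]]
    proof (rule realizes_App)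
      fix Y assume Y: "finite Y" "Y \<subseteq> {e. Sum0 e \<in> x}"
      then have "Sum0 ` Y \<subseteq> x" by auto
      with x(2) 1 Y(1) obtain a b M' where "red\<^sup>*\<^sup>* M (Const (In0 a b) \<bullet> M')" "realizes A M' Y"
        by (rule adequate_Tag0)
      then show "\<exists>N'. red\<^sup>*\<^sup>* ?K (N \<bullet> N') \<and> realizes A N' Y" using ctx[OF _ red.case_0] by blast
    qed
  next
    case 2
    then have "X \<subseteq> fn_app g {e. Sum1 e \<in> x}" using X(2) by (simp add: case_val_def)
    with g X(1) show ?thesis using points_consistent[OF Sum1_points[OF x(1)]]
    proof (rule realizes_App)
      fix Y assume Y: "finite Y" "Y \<subseteq> {e. Sum1 e \<in> x}"
      then have "Sum1 ` Y \<subseteq> x" by auto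
      with x(2) 2(2) Y(1) obtain a b M' where "red\<^sup>*\<^sup>* M (Const (In1 a b) \<bullet> M')" "realizes B M' Y"
        by (rule adequate_Tag1)
      then show "\<exists>N'. red\<^sup>*\<^sup>* ?K (P \<bullet> N') \<and> realizes B N' Y" using ctx[OF _ red.case_1] by blast
    qed
  qed (simp add: realizes_empty)
qed

text \<open>A decided scrutinee reduces to an injection and selects a branch. With an undecided one
  the value is \<open>b \<inter> c\<close>, so both branches realize each finite part of it, and
  \<open>realizes_pcase\<close> applies whatever the scrutinee does.\<close>

lemma adequate_pcase:
  assumes x: "adequate (NSum A B) M x" and b: "adequate C N b" and c: "adequate C P c"
    and r: "closed_ty r" "tree_of r = C"
  shows "adequate C (Const (Pcase s t r) \<bullet> M \<bullet> N \<bullet> P) (pcase_val x b c)" (is "adequate C ?K _")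
proof -
  have ctx: "red\<^sup>*\<^sup>* ?K K" if "red\<^sup>*\<^sup>* M M'" "red (Const (Pcase s t r) \<bullet> M' \<bullet> N \<bullet> P) K" for M' K
    using red_star_App1[OF red_star_App1[OF red_star_App2[OF that(1)]]] that(2)
    by (rule rtranclp.rtrancl_into_rtrancl)
  consider "Tag0 \<in> x" | "Tag0 \<notin> x" "Tag1 \<in> x" | "Tag0 \<notin> x" "Tag1 \<notin> x" by blast
  then show ?thesis
  proof cases
    case 1
    with x obtain a' b' M' where "red\<^sup>*\<^sup>* M (Const (In0 a' b') \<bullet> M')"
      by (rule adequate_Tag0[of A B M x "{}"]) simp_all
    then have "adequate C ?K b" using ctx[OF _ red.pcase_0] adequate_expand[OF b] by blast
    then show ?thesis using 1 by (simp add: pcase_val_def)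
  next
    case 2
    from x 2(2) obtain a' b' M' where "red\<^sup>*\<^sup>* M (Const (In1 a' b') \<bullet> M')"
      by (rule adequate_Tag1[of A B M x "{}"]) simp_all
    then have "adequate C ?K c" using ctx[OF _ red.pcase_1] adequate_expand[OF c] by blast
    then show ?thesis using 2 by (simp add: pcase_val_def)
  next
    case 3
    have "adequate C ?K (b \<inter> c)"
      using b c realizes_pcase[OF _ _ r] unfolding adequate_def by simp
    then show ?thesis using 3 by (simp add: pcase_val_def)
  qed
qed

text \<open>Arguments are peeled off by \<open>adequate_abs\<close>, each with its continuity lemma,
  until the constant is fully applied. \<open>Omega\<close> denotes the empty set, whose only finite
  part is realized by every term.\<close>

lemma adequate_const:
  assumes "closed_ty (const_ty c)"
  shows "adequate (tree_of (const_ty c)) (Const c) (const_sem c)"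
proof (cases c)
  case (In0 s t)
  then show ?thesis using assms
    by (auto simp: fn_abs_ty_ps intro!: adequate_abs contin_inj0 adequate_inj0)
next
  case (In1 s t)
  then show ?thesis using assms
    by (auto simp: fn_abs_ty_ps intro!: adequate_abs contin_inj1 adequate_inj1)
next
  case (Case s t r)
  show ?thesis unfolding Case const_ty.simps const_sem.simps tree_of_simps fn_abs_ty_ps
    by (intro adequate_abs contin_case1 contin_case2 contin_case_val3 adequate_case)
next
  case (Pcase s t r)
  have "closed_ty r" using assms Pcase by simp
  then show ?thesis unfolding Pcase const_ty.simps const_sem.simps tree_of_simps fn_abs_ty_ps
    by (intro adequate_abs contin_pcase1 contin_pcase2 contin_pcase_val3 adequate_pcase refl)
next
  case (Pair s t)
  have "closed_ty s" "closed_ty t" using assms Pair by simp_all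
  then show ?thesis unfolding Pair const_ty.simps const_sem.simps tree_of_simps fn_abs_ty_ps
    by (intro adequate_abs contin_pair contin_pair_val2 adequate_pair refl)
next
  case (Fst s t)
  show ?thesis unfolding Fst const_ty.simps const_sem.simps tree_of_simps fn_abs_ty_ps
    by (intro adequate_abs contin_fst_val adequate_fst)
next
  case (Snd s t)
  show ?thesis unfolding Snd const_ty.simps const_sem.simps tree_of_simps fn_abs_ty_ps
    by (intro adequate_abs contin_snd_val adequate_snd)
next
  case (Omega s)
  then show ?thesis by (simp add: adequate_def realizes_empty)
qed

text \<open>The fundamental lemma of the logical relation. In the abstraction case \<beta>-expansion
  leads from the body with \<open>N\<close> at index 0 back to the application.\<close>

lemma adequate_sem:
  "has_ty G M t \<Longrightarrow> env_ok G e \<Longrightarrow> (\<And>i. i < length G \<Longrightarrow> adequate (tree_of (G ! i)) (g i) (e i)) \<Longrightarrow>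
   adequate (tree_of t) (psubst g M) (sem M e)"
proof (induction arbitrary: e g rule: has_ty.induct)
  case (ty_Var i G)
  then show ?case by simp
next
  case (ty_Const c G)
  then show ?case by (simp add: adequate_const)
next
  case (ty_App G M s t N)
  have "adequate (NFun (tree_of s) (tree_of t)) (psubst g M) (sem M e)"
    using ty_App.IH(1)[OF ty_App.prems] by simp
  then show ?case
    using adequate_App ty_App.IH(2)[OF ty_App.prems] sem_points[OF ty_App.hyps(2) ty_App.prems(1)]
    by simp
next
  case (ty_Lam s G M t)
  have "adequate (NFun (tree_of s) (tree_of t)) (Lam s (psubst (up g) M))
    (tree_abs (tree_of s) (\<lambda>d. sem M (case_nat d e)))"
  proof (rule adequate_abs)
    show "contin (tree_of s) (tree_of t) (\<lambda>d. sem M (case_nat d e))"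
      by (rule contin_sem) (rule sem_points[OF ty_Lam.hyps(2) env_ok_Cons[OF ty_Lam.prems(1)]])
    fix N d assume d: "d \<in> points (tree_of s)" "adequate (tree_of s) N d"
    have "adequate (tree_of t) (psubst (case_nat N g) M) (sem M (case_nat d e))"
    proof (rule ty_Lam.IH)
      show "env_ok (s # G) (case_nat d e)" using ty_Lam.prems(1) d(1) by (rule env_ok_Cons)
      show "adequate (tree_of ((s # G) ! i)) (case_nat N g i) (case_nat d e i)"
        if "i < length (s # G)" for i
        using that d(2) ty_Lam.prems(2) by (cases i) auto
    qed
    moreover have "red\<^sup>*\<^sup>* (Lam s (psubst (up g) M) \<bullet> N) (psubst (case_nat N g) M)"
      using red.beta[of s "psubst (up g) M" N] by (simp add: subst_psubst_up r_into_rtranclp)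
    ultimately show "adequate (tree_of t) (Lam s (psubst (up g) M) \<bullet> N) (sem M (case_nat d e))"
      by (rule adequate_expand)
  qed
  then show ?case by (simp add: fn_abs_ty_ps)
next
  case (ty_conv G M s t)
  then show ?case by (simp add: ty_equiv_def)
qed

theorem mainTheorem16:
  fixes M :: tm
  assumes "program M"
  shows "op_eval M = den M"
proof -
  have ty: "has_ty [] M ty_bool" using assms by (simp add: program_def)
  have e: "env_ok [] (\<lambda>_. {})" by (simp add: env_ok_def)
  have ad: "adequate (NSum NVoid NVoid) M (den M)"
    \<comment> \<open>Over the empty context the identity substitution meets the hypotheses
      vacuously.\<close>
    using adequate_sem[OF ty e, of Var] by (simp add: psubst_Var den_def ty_bool_def)
  have pt: "den M \<in> points (NSum NVoid NVoid)"
    using sem_points[OF ty e] by (simp add: den_def ty_bool_def)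
  \<comment> \<open>The sum of two empty prime systems has only the two tags as primes.\<close>
  consider "Tag0 \<in> den M" | "Tag1 \<in> den M" | "den M = {}"
    using points_prime_of[OF pt] by fastforce
  then show ?thesis
  proof cases
    case 1
    with ad obtain a b M' where M': "red\<^sup>*\<^sup>* M (Const (In0 a b) \<bullet> M')"
      by (rule adequate_Tag0[of _ _ _ _ "{}"]) simp_all
    then have "op_eval M = {Tag0}" unfolding op_eval_def by auto
    then show ?thesis using den_In0[OF assms M'] by simp
  next
    case 2
    with ad obtain a b M' where M': "red\<^sup>*\<^sup>* M (Const (In1 a b) \<bullet> M')"
      by (rule adequate_Tag1[of _ _ _ _ "{}"]) simp_all
    then have den: "den M = {Tag1}" using den_In1[OF assms] by blast
    \<comment> \<open>\<open>op_eval\<close> tests for the first injection before the second;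
      soundness shows that the first test fails.\<close>
    then have "\<nexists>s t M'. red\<^sup>*\<^sup>* M (Const (In0 s t) \<bullet> M')" using den_In0[OF assms] by auto
    then show ?thesis using M' den unfolding op_eval_def by auto
  next
    case 3
    then have "\<nexists>s t M'. red\<^sup>*\<^sup>* M (Const (In0 s t) \<bullet> M')" "\<nexists>s t M'. red\<^sup>*\<^sup>* M (Const (In1 s t) \<bullet> M')"
      using den_In0[OF assms] den_In1[OF assms] by auto
    then show ?thesis using 3 unfolding op_eval_def by simp
  qed
qed

end
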